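(* Let $X,Y,Z$ be complete Hausdorff topological vector spaces connected by a bilinear product, with $X$, $Y$ and $Z$ metrizable. Let $\mathcal H$ be a $\sigma$-algebra of subsets of $\Omega$ and let $\mathbb S$ be a non-empty family of (extended real valued) submeasures on $\mathcal H$ possessing a control submeasure. Let $\mu:\mathcal H\to Y$ be $\sigma$-additive with finite semivariation on $\mathcal H$, and assume Massé's hypotheses $(M_1)$ and $(M_2)$ for $\mu$ and $\mathbb S$ (with a given family $\mathcal H^\mu_{\mathbb S}$ of $\mathbb S_\mu$-integrable sets). If $f:\Omega\to X$ is Massé integrable on each $A\in\mathcal H$ with respect to $\mu$, then $f$ is $S^*$-integrable on each $A\in\mathcal H$, and the two integrals agree.
   Context: All vector spaces are real; convergence is topological. The bilinear product $X\times Y\to Z$ (juxtaposition) is bilinear and continuous in each argument separately. A submeasure on $\mathcal H$ is a map $\xi:\mathcal H\to[0,\infty]$ with $\xi(\emptyset)=0$ that is monotone and subadditive; on arbitrary $E\subseteq\Omega$ it is evaluated through $\xi(E)=\inf\{\xi(A):E\subseteq A\in\mathcal H\}$. A control submeasure for $\mathbb S$ is a submeasure $\eta$ on $\mathcal H$ inducing the same topology as $\mathbb S$: for nets $(E_l)$ in $\mathcal H$, $\eta(E_l)\to0$ iff $\xi(E_l)\to0$ for all $\xi\in\mathbb S$. A set function is $\sigma$-additive if the measure of a disjoint countable union is the unconditional sum of the measures. $\mu$ has finite semivariation if for every neighborhood $W$ of $0$ in $Z$ there is a neighborhood $U$ of $0$ in $X$ such that $\sum_{\alpha\in F}U\mu(\alpha)\subseteq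 W$ for all finite disjoint collections $F\subseteq\mathcal H$, where $U\mu(\alpha)=\{u\mu(\alpha):u\in U\}$. A net $(f_l)$ of functions $\Omega\to X$ converges to $f$ in $\mathbb S$-submeasure if $\xi(\{\omega:d(f_l(\omega)-f(\omega))>\varepsilon\})\to0$ for every $\xi\in\mathbb S$, $\varepsilon>0$ and every continuous $F$-seminorm $d$ from a family defining the topology of $X$. A sub-ring $\mathcal H^\mu_{\mathbb S}$ of $\mathcal H$ (the $\mathbb S_\mu$-integrable sets) is given. A simple function based on it is $s=\sum_{i=1}^nx_i\mathbf 1_{A_i}$ with $x_i\in X$, $A_i\in\mathcal H^\mu_{\mathbb S}$ disjoint, and $\int_As\,d\mu=\sum_ix_i\mu(A_i\cap A)$ for $A\in\mathcal H$. $(M_1)$: the operator $s\mapsto\int_\Omega s\,d\mu$ on simple functions based on $\mathcal H^\mu_{\mathbb S}$, with the topology of uniform convergence, into $Z$ is continuous. $(M_2)$: for every $x\in X$, $x\mu(E)\to0$ in $Z$ as $E\to\emptyset$ in $\mathcal H^\mu_{\mathbb S}$, i.e. along every net $(E_l)$ in $\mathcal H^\mu_{\mathbb S}$ with $\xi(E_l)\to0$ for all $\xi\in\mathbb S$. $f:\Omega\to X$ is Massé integrable if there is a net $(f_l)$ of simple functions based on $\mathcal H^\mu_{\mathbb S}$ with $f_l\to f$ in $\mathbb S$-submeasure such that $(\int_Af_l\,d\mu)_l$ is Cauchy in $Z$ uniformly for $A\in\mathcal H$; then $\int_A^{(M)}f\,d\mu=\lim_l\int_Af_l\,d\mu$ (well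 defined). $S^*$-integral on $A\in\mathcal H$: let $\mathcal P(A)$ be the set of countable disjoint coverings of $A$ by nonempty sets of $\mathcal H$, ordered by refinement ($P\le Q$ iff every member of $Q$ is contained in a member of $P$). A choice function $\delta$ selects $\delta_\alpha\in\alpha$ for every nonempty $\alpha\subseteq\Omega$. $f$ is $S^*$-integrable on $A$ with integral $z\in Z$ if there is $P_*\in\mathcal P(A)$ such that for all $P\ge P_*$ and all $\delta$ the series $\sum_{\alpha\in P}f(\delta_\alpha)\mu(\alpha)$ is unconditionally convergent in $Z$, and for every neighborhood $U$ of $0$ in $Z$ there is $P_0\in\mathcal P(A)$ with $\sum_{\alpha\in P}f(\delta_\alpha)\mu(\alpha)-z\in U$ for all $P\ge P_0$ and all $\delta$.
   Formalization: The formal theorem also assumes that every set of the σ-algebra that is null for all submeasures in S belongs to the given ring of S_μ-integrable sets; for an arbitrary sub-ring the claim fails (one-point Ω, S={0}, ring {∅}, f=1: Massé integral 0, S*-integral 1). *)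

theory Defs
  imports "HOL-Analysis.Analysis"
begin

text \<open>
  Nets are rendered as filters throughout: a net in a set \<open>T\<close> is represented by the filter it
  generates on \<open>T\<close>, i.e. a proper filter \<open>F \<le> principal T\<close>, and every such filter arises from
  a net.
\<close>

subsection \<open>Topological vector spaces\<close>

class real_tvs = real_vector + topological_ab_group_add +
  assumes tendsto_scaleR_tvs:
    "filterlim (\<lambda>p. fst p *\<^sub>R snd p) (nhds (c *\<^sub>R x)) (nhds c \<times>\<^sub>F nhds x)"

definition tvs_cauchy_filter :: "'a::real_tvs filter \<Rightarrow> bool" where
  "tvs_cauchy_filter F \<longleftrightarrow> filterlim (\<lambda>p. fst p - snd p) (nhds 0) (F \<times>\<^sub>F F)"

definition tvs_complete :: "'a::real_tvs itself \<Rightarrow> bool" where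
  "tvs_complete _ \<longleftrightarrow>
     (\<forall>F :: 'a filter. F \<noteq> bot \<longrightarrow> tvs_cauchy_filter F \<longrightarrow> (\<exists>l. F \<le> nhds l))"

definition separately_continuous_bilinear ::
  "('x::real_tvs \<Rightarrow> 'y::real_tvs \<Rightarrow> 'z::real_tvs) \<Rightarrow> bool" where
  "separately_continuous_bilinear p \<longleftrightarrow>
     bilinear p \<and> (\<forall>x. continuous_on UNIV (\<lambda>y. p x y)) \<and> (\<forall>y. continuous_on UNIV (\<lambda>x. p x y))"

definition F_seminorm :: "('x::real_vector \<Rightarrow> real) \<Rightarrow> bool" where
  "F_seminorm d \<longleftrightarrow>
     (\<forall>x. 0 \<le> d x) \<and> (\<forall>x y. d (x + y) \<le> d x + d y) \<and>
     (\<forall>c x. \<bar>c\<bar> \<le> 1 \<longrightarrow> d (c *\<^sub>R x) \<le> d x) \<and>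
     (\<forall>x. ((\<lambda>c. d (c *\<^sub>R x)) \<longlongrightarrow> 0) (at 0))"

definition defining_F_seminorms :: "('x::real_tvs \<Rightarrow> real) set \<Rightarrow> bool" where
  "defining_F_seminorms D \<longleftrightarrow>
     (\<forall>d\<in>D. F_seminorm d \<and> continuous_on UNIV d) \<and>
     nhds 0 = (INF d\<in>D. INF e\<in>{0<..}. principal {x. d x < e})"

subsection \<open>Submeasures\<close>

definition submeasure :: "'w set set \<Rightarrow> ('w set \<Rightarrow> ennreal) \<Rightarrow> bool" where
  "submeasure H \<xi> \<longleftrightarrow>
     \<xi> {} = 0 \<and> (\<forall>A\<in>H. \<forall>B\<in>H. A \<subseteq> B \<longrightarrow> \<xi> A \<le> \<xi> B) \<and>
     (\<forall>A\<in>H. \<forall>B\<in>H. \<xi> (A \<union> B) \<le> \<xi> A + \<xi> B)"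

definition submeasure_ext :: "'w set set \<Rightarrow> ('w set \<Rightarrow> ennreal) \<Rightarrow> 'w set \<Rightarrow> ennreal" where
  "submeasure_ext H \<xi> E = (INF A\<in>{A\<in>H. E \<subseteq> A}. \<xi> A)"

definition control_submeasure ::
  "'w set set \<Rightarrow> ('w set \<Rightarrow> ennreal) set \<Rightarrow> ('w set \<Rightarrow> ennreal) \<Rightarrow> bool" where
  "control_submeasure H S \<eta> \<longleftrightarrow>
     submeasure H \<eta> \<and>
     (\<forall>F. F \<le> principal H \<longrightarrow> ((\<eta> \<longlongrightarrow> 0) F \<longleftrightarrow> (\<forall>\<xi>\<in>S. (\<xi> \<longlongrightarrow> 0) F)))"

subsection \<open>Vector measures\<close>

definition sigma_additive ::
  "'w set set \<Rightarrow> ('w set \<Rightarrow> 'y::{comm_monoid_add,topological_space}) \<Rightarrow> bool" where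
  "sigma_additive H \<mu> \<longleftrightarrow>
     (\<forall>A :: nat \<Rightarrow> 'w set. range A \<subseteq> H \<longrightarrow> disjoint_family A \<longrightarrow>
        ((\<lambda>i. \<mu> (A i)) has_sum \<mu> (\<Union>i. A i)) UNIV)"

definition finite_semivariation ::
  "('x::real_tvs \<Rightarrow> 'y::real_tvs \<Rightarrow> 'z::real_tvs) \<Rightarrow> 'w set set \<Rightarrow> ('w set \<Rightarrow> 'y) \<Rightarrow> bool" where
  "finite_semivariation p H \<mu> \<longleftrightarrow>
     (\<forall>W. 0 \<in> interior W \<longrightarrow> (\<exists>U. 0 \<in> interior U \<and>
        (\<forall>C u. finite C \<longrightarrow> C \<subseteq> H \<longrightarrow> disjoint C \<longrightarrow> (\<forall>\<alpha>\<in>C. u \<alpha> \<in> U) \<longrightarrow>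
           (\<Sum>\<alpha>\<in>C. p (u \<alpha>) (\<mu> \<alpha>)) \<in> W)))"

subsection \<open>Simple functions and their integral\<close>

definition simple_rep ::
  "'w set \<Rightarrow> 'w set set \<Rightarrow> ('w \<Rightarrow> 'x::real_vector) \<Rightarrow> nat \<Rightarrow> (nat \<Rightarrow> 'x) \<Rightarrow> (nat \<Rightarrow> 'w set) \<Rightarrow> bool" where
  "simple_rep \<Omega> R s n x B \<longleftrightarrow>
     (\<forall>i<n. B i \<in> R) \<and> disjoint_family_on B {..<n} \<and>
     (\<forall>\<omega>\<in>\<Omega>. s \<omega> = (\<Sum>i<n. indicat_real (B i) \<omega> *\<^sub>R x i))"

definition simple_fun :: "'w set \<Rightarrow> 'w set set \<Rightarrow> ('w \<Rightarrow> 'x::real_vector) \<Rightarrow> bool" where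
  "simple_fun \<Omega> R s \<longleftrightarrow> (\<exists>n x B. simple_rep \<Omega> R s n x B)"

text \<open>Additivity of \<open>\<mu>\<close> makes the value below independent of the representation.\<close>

definition simple_fun_integral ::
  "('x::real_tvs \<Rightarrow> 'y::real_tvs \<Rightarrow> 'z::real_tvs) \<Rightarrow> 'w set \<Rightarrow> 'w set set \<Rightarrow> ('w set \<Rightarrow> 'y) \<Rightarrow>
     'w set \<Rightarrow> ('w \<Rightarrow> 'x) \<Rightarrow> 'z" where
  "simple_fun_integral p \<Omega> R \<mu> A s =
     (THE z. \<exists>n x B. simple_rep \<Omega> R s n x B \<and> z = (\<Sum>i<n. p (x i) (\<mu> (B i \<inter> A))))"

subsection \<open>The Masse integral\<close>

text \<open>
  \<open>R\<close> is the given ring of integrable sets.  Besides being a sub-ring of \<open>H\<close> it has to contain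
  the sets that are null for every \<open>\<xi> \<in> S\<close>: convergence in submeasure does not see the values
  of a function on such a set \<open>E\<close>, while \<open>masse_M2\<close> forces \<open>p x (\<mu> E) = 0\<close> only for
  \<open>E \<in> R\<close>.  With \<open>S = {\<lambda>_. 0}\<close> and \<open>R = {{}}\<close> every function would be integrable with
  integral \<open>0\<close>.
\<close>

definition masse_M1 ::
  "('x::real_tvs \<Rightarrow> 'y::real_tvs \<Rightarrow> 'z::real_tvs) \<Rightarrow> 'w set \<Rightarrow> 'w set set \<Rightarrow> ('w set \<Rightarrow> 'y) \<Rightarrow> bool" where
  "masse_M1 p \<Omega> R \<mu> \<longleftrightarrow>
     (\<forall>s\<^sub>0. simple_fun \<Omega> R s\<^sub>0 \<longrightarrow> (\<forall>W. 0 \<in> interior W \<longrightarrow> (\<exists>U. 0 \<in> interior U \<and>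
        (\<forall>s. simple_fun \<Omega> R s \<longrightarrow> (\<forall>\<omega>\<in>\<Omega>. s \<omega> - s\<^sub>0 \<omega> \<in> U) \<longrightarrow>
           simple_fun_integral p \<Omega> R \<mu> \<Omega> s - simple_fun_integral p \<Omega> R \<mu> \<Omega> s\<^sub>0 \<in> W))))"

definition masse_M2 ::
  "('x::real_tvs \<Rightarrow> 'y::real_tvs \<Rightarrow> 'z::real_tvs) \<Rightarrow> 'w set set \<Rightarrow> ('w set \<Rightarrow> ennreal) set \<Rightarrow>
     ('w set \<Rightarrow> 'y) \<Rightarrow> bool" where
  "masse_M2 p R S \<mu> \<longleftrightarrow>
     (\<forall>x F. F \<le> principal R \<longrightarrow> (\<forall>\<xi>\<in>S. (\<xi> \<longlongrightarrow> 0) F) \<longrightarrow> ((\<lambda>E. p x (\<mu> E)) \<longlongrightarrow> 0) F)"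

definition converges_in_submeasure ::
  "'w set \<Rightarrow> 'w set set \<Rightarrow> ('w set \<Rightarrow> ennreal) set \<Rightarrow> ('x::real_tvs \<Rightarrow> real) set \<Rightarrow>
     ('w \<Rightarrow> 'x) filter \<Rightarrow> ('w \<Rightarrow> 'x) \<Rightarrow> bool" where
  "converges_in_submeasure \<Omega> H S D F f \<longleftrightarrow>
     (\<forall>\<xi>\<in>S. \<forall>\<epsilon>>0. \<forall>d\<in>D.
        ((\<lambda>g. submeasure_ext H \<xi> {\<omega>\<in>\<Omega>. d (g \<omega> - f \<omega>) > \<epsilon>}) \<longlongrightarrow> 0) F)"

definition masse_approx ::
  "('x::real_tvs \<Rightarrow> 'y::real_tvs \<Rightarrow> 'z::real_tvs) \<Rightarrow> 'w set \<Rightarrow> 'w set set \<Rightarrow>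
     ('w set \<Rightarrow> ennreal) set \<Rightarrow> ('x \<Rightarrow> real) set \<Rightarrow> 'w set set \<Rightarrow> ('w set \<Rightarrow> 'y) \<Rightarrow>
     ('w \<Rightarrow> 'x) filter \<Rightarrow> ('w \<Rightarrow> 'x) \<Rightarrow> bool" where
  "masse_approx p \<Omega> H S D R \<mu> F f \<longleftrightarrow>
     F \<noteq> bot \<and> F \<le> principal {s. simple_fun \<Omega> R s} \<and>
     converges_in_submeasure \<Omega> H S D F f \<and>
     (\<forall>W. 0 \<in> interior W \<longrightarrow>
        (\<forall>\<^sub>F q in F \<times>\<^sub>F F. \<forall>A\<in>H.
           simple_fun_integral p \<Omega> R \<mu> A (fst q) - simple_fun_integral p \<Omega> R \<mu> A (snd q) \<in> W))"

definition masse_integrable ::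
  "('x::real_tvs \<Rightarrow> 'y::real_tvs \<Rightarrow> 'z::real_tvs) \<Rightarrow> 'w set \<Rightarrow> 'w set set \<Rightarrow>
     ('w set \<Rightarrow> ennreal) set \<Rightarrow> ('x \<Rightarrow> real) set \<Rightarrow> 'w set set \<Rightarrow> ('w set \<Rightarrow> 'y) \<Rightarrow>
     ('w \<Rightarrow> 'x) \<Rightarrow> bool" where
  "masse_integrable p \<Omega> H S D R \<mu> f \<longleftrightarrow> (\<exists>F. masse_approx p \<Omega> H S D R \<mu> F f)"

definition masse_integral ::
  "('x::real_tvs \<Rightarrow> 'y::real_tvs \<Rightarrow> 'z::real_tvs) \<Rightarrow> 'w set \<Rightarrow> 'w set set \<Rightarrow>
     ('w set \<Rightarrow> ennreal) set \<Rightarrow> ('x \<Rightarrow> real) set \<Rightarrow> 'w set set \<Rightarrow> ('w set \<Rightarrow> 'y) \<Rightarrow>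
     'w set \<Rightarrow> ('w \<Rightarrow> 'x) \<Rightarrow> 'z" where
  "masse_integral p \<Omega> H S D R \<mu> A f =
     (THE z. \<exists>F. masse_approx p \<Omega> H S D R \<mu> F f \<and> (simple_fun_integral p \<Omega> R \<mu> A \<longlongrightarrow> z) F)"

subsection \<open>The \<open>S\<^sup>*\<close>-integral\<close>

definition countable_partitions :: "'w set set \<Rightarrow> 'w set \<Rightarrow> 'w set set set" where
  "countable_partitions H A = {P. countable P \<and> P \<subseteq> H \<and> {} \<notin> P \<and> disjoint P \<and> \<Union>P = A}"

definition partition_le :: "'w set set \<Rightarrow> 'w set set \<Rightarrow> bool" where
  "partition_le P Q \<longleftrightarrow> (\<forall>\<beta>\<in>Q. \<exists>\<alpha>\<in>P. \<beta> \<subseteq> \<alpha>)"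

definition choice_function :: "'w set \<Rightarrow> ('w set \<Rightarrow> 'w) \<Rightarrow> bool" where
  "choice_function \<Omega> \<delta> \<longleftrightarrow> (\<forall>\<alpha>. \<alpha> \<noteq> {} \<longrightarrow> \<alpha> \<subseteq> \<Omega> \<longrightarrow> \<delta> \<alpha> \<in> \<alpha>)"

text \<open>
  The value of \<open>infsum\<close> on non-summable families is immaterial: \<open>P\<^sub>0\<close> may always be refined so
  that \<open>Ps \<le> P\<^sub>0\<close>.
\<close>

definition has_sstar_integral ::
  "('x::real_tvs \<Rightarrow> 'y::real_tvs \<Rightarrow> 'z::{real_tvs,t2_space}) \<Rightarrow> 'w set \<Rightarrow> 'w set set \<Rightarrow>
     ('w set \<Rightarrow> 'y) \<Rightarrow> 'w set \<Rightarrow> ('w \<Rightarrow> 'x) \<Rightarrow> 'z \<Rightarrow> bool" where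
  "has_sstar_integral p \<Omega> H \<mu> A f z \<longleftrightarrow>
     (\<exists>Ps \<in> countable_partitions H A. \<forall>P \<in> countable_partitions H A. partition_le Ps P \<longrightarrow>
        (\<forall>\<delta>. choice_function \<Omega> \<delta> \<longrightarrow> (\<lambda>\<alpha>. p (f (\<delta> \<alpha>)) (\<mu> \<alpha>)) summable_on P)) \<and>
     (\<forall>U. 0 \<in> interior U \<longrightarrow>
        (\<exists>P\<^sub>0 \<in> countable_partitions H A. \<forall>P \<in> countable_partitions H A. partition_le P\<^sub>0 P \<longrightarrow>
           (\<forall>\<delta>. choice_function \<Omega> \<delta> \<longrightarrow> (\<Sum>\<^sub>\<infinity>\<alpha>\<in>P. p (f (\<delta> \<alpha>)) (\<mu> \<alpha>)) - z \<in> U)))"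

end

theory Submission
  imports Defs
begin

text \<open>
  Let \<open>\<nu> A\<close> be the limit of the integrals over \<open>A\<close> of the approximating simple functions. Two things make
  the Riemann sums of \<open>f\<close> converge to \<open>\<nu>\<close>: a decomposition of \<open>\<Omega>\<close> on whose parts simple functions
  approximate \<open>f\<close> uniformly, and finite semivariation, which bounds Riemann sums of uniformly small
  functions independently of the number of terms.

  Since \<open>Z\<close> is metrizable and there is a control submeasure \<open>\<eta>\<close>, one extracts a sequence \<open>g n\<close> of simple
  functions and sets \<open>E n\<close> with \<open>\<eta> (E n) \<le> 2\<^sup>-\<^sup>n\<close>, such that off \<open>E n\<close> the values of \<open>g n - f\<close> are in a
  neighbourhood that finite semivariation sends into the \<open>n\<close>-th set \<open>W n\<close> of a neighbourhood base, and
  the integrals of \<open>g n\<close> differ from \<open>\<nu>\<close> by an element of \<open>W n\<close>, uniformly on \<open>H\<close>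
  (\<open>approximating_simple_function\<close>). The points that lie in infinitely many \<open>E n\<close> form a set on which
  every \<open>x\<mu>\<close> vanishes. As \<open>\<eta>\<close> is only finitely subadditive, this needs the \<open>\<sigma>\<close>-additivity of \<open>\<mu>\<close>
  in addition (\<open>limsup_null\<close>). Every other point has a rank, the first \<open>k\<close> from which on it is
  outside all \<open>E n\<close>.

  For a partition into level sets of \<open>g (j + k)\<close> on the points of rank \<open>k\<close>, and for all its
  refinements, a finite Riemann sum over pieces of rank \<open>k\<close> differs from \<open>\<nu>\<close> of their union by an error
  of size \<open>W (j + k)\<close>, up to a shift of the index: on such pieces the Riemann sum of \<open>g (j + k)\<close> is its
  integral. Summing over \<open>k\<close> gives an error in \<open>W j\<close> for every finite part of the partition
  (\<open>Riemann_sum_close\<close>). The same estimate for high ranks, together with the \<open>\<sigma>\<close>-additivity of \<open>\<nu>\<close> and \<open>\<mu>\<close>,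
  proves unconditional convergence (\<open>Riemann_series_summable\<close>), and in the limit the Riemann series is
  within \<open>W j\<close> of \<open>\<nu> A\<close>.

  Finally, an \<open>S\<^sup>*\<close>-integral is unique, so \<open>\<nu> A\<close> does not depend on the approximating filter and is the
  Masse integral.
\<close>

section \<open>Neighbourhoods of zero\<close>

lemma zero_interior_iff_eventually:
  "0 \<in> interior U \<longleftrightarrow> (\<forall>\<^sub>F x in nhds 0. x \<in> U)"
  by (auto simp: interior_def eventually_nhds subset_iff)

lemma zero_interior_mem: "0 \<in> interior U \<Longrightarrow> 0 \<in> U"
  using interior_subset by blast

lemma small_sum_nbhd:
  fixes U :: "'a::topological_ab_group_add set"
  assumes "0 \<in> interior U"
  obtains A where "open A" "0 \<in> A" "\<And>a b. a \<in> A \<Longrightarrow> b \<in> A \<Longrightarrow> a + b \<in> U"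
proof -
  have "((\<lambda>q. fst q + snd q) \<longlongrightarrow> 0 + 0) (nhds (0::'a) \<times>\<^sub>F nhds (0::'a))"
    by (intro tendsto_add filterlim_fst filterlim_snd)
  then have "\<forall>\<^sub>F q in nhds (0::'a) \<times>\<^sub>F nhds (0::'a). fst q + snd q \<in> interior U"
    using assms by (intro topological_tendstoD) auto
  then obtain P Q where PQ: "eventually P (nhds (0::'a))" "eventually Q (nhds (0::'a))"
    "\<And>x y. P x \<Longrightarrow> Q y \<Longrightarrow> x + y \<in> interior U"
    unfolding eventually_prod_filter by auto
  from eventually_conj[OF PQ(1,2)] obtain A where "open A" "0 \<in> A" "\<forall>x\<in>A. P x \<and> Q x"
    unfolding eventually_nhds by blast
  then show thesis
    using PQ(3) interior_subset[of U] by (intro that[of A]) blast+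
qed

text \<open>
  Two halvings make room for the closure: with \<open>S\<close> symmetric and \<open>S + S \<subseteq> B\<close>, the closure of \<open>S\<close>
  lies in \<open>S + S\<close>, hence in \<open>B\<close>. Closedness is what later lets an estimate for finite sums pass to
  the limit.
\<close>

lemma half_nbhd:
  fixes U :: "'a::topological_ab_group_add set"
  assumes "0 \<in> interior U"
  shows "\<exists>A. closed A \<and> 0 \<in> interior A \<and> (\<forall>a\<in>A. - a \<in> A) \<and> (\<forall>a\<in>A. \<forall>b\<in>A. a + b \<in> U)"
proof -
  obtain B where B: "open B" "0 \<in> B" "\<And>a b. a \<in> B \<Longrightarrow> b \<in> B \<Longrightarrow> a + b \<in> U"
    using small_sum_nbhd[OF assms] by blast
  obtain C where C: "open C" "0 \<in> C" "\<And>a b. a \<in> C \<Longrightarrow> b \<in> C \<Longrightarrow> a + b \<in> B"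
    using small_sum_nbhd[of B] B by (metis interior_open)
  define S where "S = C \<inter> uminus -` C"
  have S: "open S" "0 \<in> S"
    unfolding S_def using C by (auto intro!: open_Int open_vimage continuous_intros)
  have clB: "x \<in> B" if "x \<in> closure S" for x
  proof -
    have "open ((\<lambda>y. x - y) -` S)"
      using S by (intro open_vimage continuous_intros)
    moreover have "x \<in> (\<lambda>y. x - y) -` S" using S by simp
    ultimately have "(\<lambda>y. x - y) -` S \<inter> S \<noteq> {}"
      using that open_Int_closure_eq_empty[of "(\<lambda>y. x - y) -` S" S] by blast
    then obtain y where "y \<in> S" "x - y \<in> S"
      by blast
    then show ?thesis
      using C(3)[of y "x - y"] by (simp add: S_def)
  qed
  define A where "A = closure S \<inter> uminus -` closure S"
  show ?thesis
  proof (intro exI[of _ A] conjI ballI)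
    show "closed A"
      unfolding A_def by (intro closed_Int closed_vimage closed_closure continuous_intros)
    have "open (S \<inter> uminus -` S)" using S by (intro open_Int open_vimage continuous_intros)
    moreover have "0 \<in> S \<inter> uminus -` S" using S by simp
    moreover have "S \<inter> uminus -` S \<subseteq> A" unfolding A_def using closure_subset[of S] by blast
    ultimately show "0 \<in> interior A" by (meson interiorI)
    show "- a \<in> A" if "a \<in> A" for a using that by (simp add: A_def)
    show "a + b \<in> U" if "a \<in> A" "b \<in> A" for a b
      using that B(3) clB by (simp add: A_def)
  qed
qed

text \<open>
  In a metrizable group the sets of such a chain do the work of the balls of radius \<open>2\<^sup>-\<^sup>n\<close>, without
  a translation invariant metric having to be constructed.
\<close>

locale zero_chain =
  fixes W :: "nat \<Rightarrow> 'a::topological_ab_group_add set"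
  assumes closed_W: "closed (W n)"
    and zero_W: "0 \<in> interior (W n)"
    and minus_W: "a \<in> W n \<Longrightarrow> - a \<in> W n"
    and add_W: "a \<in> W (Suc n) \<Longrightarrow> b \<in> W (Suc n) \<Longrightarrow> a + b \<in> W n"
    and base_W: "0 \<in> interior U \<Longrightarrow> \<exists>n. W n \<subseteq> U"
begin

lemma zero_mem_W: "0 \<in> W n"
  using zero_W zero_interior_mem by blast

lemma W_Suc_subset: "W (Suc n) \<subseteq> W n"
  using add_W[OF _ zero_mem_W] by force

lemma W_antimono: "m \<le> n \<Longrightarrow> W n \<subseteq> W m"
  by (rule lift_Suc_antimono_le[of W]) (rule W_Suc_subset)

lemma diff_W: "a \<in> W (Suc n) \<Longrightarrow> b \<in> W (Suc n) \<Longrightarrow> a - b \<in> W n"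
  using add_W[of a n "- b"] minus_W by simp

text \<open>
  The counterpart of \<open>2\<^sup>-\<^sup>k\<^sup>-\<^sup>1 + 2\<^sup>-\<^sup>k\<^sup>-\<^sup>2 + \<dots> \<le> 2\<^sup>-\<^sup>k\<close>: countably many errors can be added as long as
  the error with index \<open>i\<close> is in \<open>W (i + 1)\<close>.
\<close>

lemma sum_interval_W:
  "(\<And>i. k \<le> i \<Longrightarrow> w i \<in> W (Suc i)) \<Longrightarrow> (\<Sum>i\<in>{k..<k + l}. w i) \<in> W k"
proof (induction l arbitrary: k)
  case 0
  then show ?case using zero_mem_W by simp
next
  case (Suc l)
  have "(\<Sum>i\<in>{k..<k + Suc l}. w i) = w k + (\<Sum>i\<in>{Suc k..<Suc k + l}. w i)"
    by (subst sum.atLeast_Suc_lessThan) auto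
  moreover have "(\<Sum>i\<in>{Suc k..<Suc k + l}. w i) \<in> W (Suc k)"
    using Suc.prems by (intro Suc.IH) auto
  ultimately show ?case
    using add_W Suc.prems by simp
qed

lemma sum_W:
  assumes "finite I" "\<And>i. i \<in> I \<Longrightarrow> k \<le> i \<and> w i \<in> W (Suc i)"
  shows "sum w I \<in> W k"
proof -
  obtain l where l: "I \<subseteq> {k..<k + l}"
  proof
    show "I \<subseteq> {k..<k + Suc (Max I)}"
      using assms Max_ge[OF assms(1)] by (fastforce simp: less_Suc_eq_le intro: trans_le_add2)
  qed
  have "sum w I = (\<Sum>i\<in>{k..<k + l}. if i \<in> I then w i else 0)"
    using l by (simp add: sum.inter_restrict[symmetric] Int_absorb1)
  also have "\<dots> \<in> W k"
    using assms zero_mem_W by (intro sum_interval_W) auto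
  finally show ?thesis .
qed

end

lemma zero_chain_separates:
  fixes a :: "'a::{topological_ab_group_add,t2_space}"
  assumes "zero_chain W" "\<And>n. a \<in> W n"
  shows "a = 0"
proof (rule ccontr)
  assume "a \<noteq> 0"
  then obtain U where U: "open U" "0 \<in> U" "a \<notin> U"
    by (metis t1_space)
  then have "0 \<in> interior U" by (simp add: interior_open)
  then obtain n where "W n \<subseteq> U" using zero_chain.base_W[OF assms(1)] by blast
  then show False using assms(2) U(3) by blast
qed

lemma zero_chain_exists:
  assumes "metrizable_space (euclidean :: 'a::topological_ab_group_add topology)"
  obtains W :: "nat \<Rightarrow> 'a::topological_ab_group_add set" where "zero_chain W"
proof -
  have "first_countable (euclidean :: 'a topology)"
    using assms by (rule metrizable_imp_first_countable)
  moreover have "(0::'a) \<in> topspace euclidean" by simp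
  ultimately have "\<exists>\<B>::'a set set. countable \<B> \<and> (\<forall>V\<in>\<B>. openin euclidean V) \<and>
      (\<forall>U. openin euclidean U \<and> 0 \<in> U \<longrightarrow> (\<exists>V\<in>\<B>. 0 \<in> V \<and> V \<subseteq> U))"
    unfolding first_countable_def by (rule bspec)
  then
  obtain \<B> :: "'a set set" where \<B>0: "countable \<B>" "\<forall>V\<in>\<B>. openin euclidean V"
    "\<forall>U. openin euclidean U \<and> 0 \<in> U \<longrightarrow> (\<exists>V\<in>\<B>. 0 \<in> V \<and> V \<subseteq> U)"
    by (elim exE conjE) (rule that)
  have \<B>: "countable \<B>" "\<And>V. V \<in> \<B> \<Longrightarrow> open V"
    "\<And>U. open U \<Longrightarrow> 0 \<in> U \<Longrightarrow> \<exists>V\<in>\<B>. 0 \<in> V \<and> V \<subseteq> U"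
    using \<B>0 by simp_all
  define \<B>' where "\<B>' = {V\<in>\<B>. 0 \<in> V}"
  have "countable \<B>'" "\<B>' \<noteq> {}"
    using \<B>(1) \<B>(3)[of UNIV] by (auto simp: \<B>'_def)
  define B where "B = from_nat_into \<B>'"
  have B: "open (B n)" "0 \<in> B n" for n
    using from_nat_into[OF \<open>\<B>' \<noteq> {}\<close>, of n] \<B>(2) by (auto simp: B_def \<B>'_def)
  have B_base: "\<exists>n. B n \<subseteq> U" if U: "0 \<in> interior U" for U
  proof -
    obtain V where "V \<in> \<B>'" "V \<subseteq> U"
      using \<B>(3)[of "interior U"] U interior_subset[of U] by (auto simp: \<B>'_def)
    then show ?thesis
      using from_nat_into_surj[OF \<open>countable \<B>'\<close>] by (metis B_def)
  qed
  define P where "P n T \<longleftrightarrow> closed T \<and> 0 \<in> interior T \<and> (\<forall>a\<in>T. - a \<in> T) \<and> T \<subseteq> B n"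
    for n and T :: "'a set"
  have step: "\<exists>T. P n T \<and> (\<forall>a\<in>T. \<forall>b\<in>T. a + b \<in> U)" if U: "0 \<in> interior U" for n U
  proof -
    have "0 \<in> interior (U \<inter> B n)"
      using U B by (simp add: interior_open)
    from half_nbhd[OF this] obtain T where T: "closed T" "0 \<in> interior T" "\<And>a. a \<in> T \<Longrightarrow> - a \<in> T"
      "\<And>a b. a \<in> T \<Longrightarrow> b \<in> T \<Longrightarrow> a + b \<in> U \<inter> B n" by blast
    then have "T \<subseteq> B n"
      using T(4)[OF _ zero_interior_mem[OF T(2)]] by force
    then show ?thesis
      unfolding P_def using T by (intro exI[of _ T]) blast
  qed
  have "\<exists>W. \<forall>n. P n (W n) \<and> (\<forall>a\<in>W (Suc n). \<forall>b\<in>W (Suc n). a + b \<in> W n)"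
  proof (rule dependent_nat_choice)
    show "\<exists>T. P 0 T"
      using step[of UNIV 0] by auto
    show "\<exists>T'. P (Suc n) T' \<and> (\<forall>a\<in>T'. \<forall>b\<in>T'. a + b \<in> T)" if "P n T" for T n
    proof (rule step)
      show "0 \<in> interior T" using that by (simp add: P_def)
    qed
  qed
  then obtain W where W: "\<And>n. P n (W n)" "\<And>n. \<forall>a\<in>W (Suc n). \<forall>b\<in>W (Suc n). a + b \<in> W n"
    by blast
  have "zero_chain W"
  proof
    fix n a b and U :: "'a set"
    show "closed (W n)" "0 \<in> interior (W n)" "a \<in> W n \<Longrightarrow> - a \<in> W n"
      using W(1)[of n] by (auto simp: P_def)
    show "a \<in> W (Suc n) \<Longrightarrow> b \<in> W (Suc n) \<Longrightarrow> a + b \<in> W n"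
      using W(2) by blast
    show "\<exists>n. W n \<subseteq> U" if U: "0 \<in> interior U"
    proof -
      obtain n where "B n \<subseteq> U" using B_base[OF U] by blast
      moreover have "W n \<subseteq> B n" using W(1)[of n] by (simp add: P_def)
      ultimately show ?thesis by blast
    qed
  qed
  then show thesis by (rule that)
qed

lemma finite_sum_nbhd:
  fixes U :: "'a::topological_ab_group_add set"
  assumes "finite I" "0 \<in> interior U"
  obtains V where "0 \<in> interior V" "\<And>w. (\<And>i. i \<in> I \<Longrightarrow> w i \<in> V) \<Longrightarrow> sum w I \<in> U"
proof -
  have "\<exists>V. 0 \<in> interior V \<and> (\<forall>w. (\<forall>i\<in>I. w i \<in> V) \<longrightarrow> sum w I \<in> U)"
    using assms
  proof (induction I arbitrary: U)
    case empty
    then show ?case using zero_interior_mem[of U] by (intro exI[of _ UNIV]) simp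
  next
    case (insert i I)
    obtain A where A: "open A" "0 \<in> A" "\<And>a b. a \<in> A \<Longrightarrow> b \<in> A \<Longrightarrow> a + b \<in> U"
      using small_sum_nbhd[OF insert.prems] by blast
    obtain V where V: "0 \<in> interior V" "\<And>w. (\<forall>i\<in>I. w i \<in> V) \<Longrightarrow> sum w I \<in> A"
      using insert.IH[of A] A by (metis interior_open)
    show ?case
    proof (intro exI conjI allI impI)
      show "0 \<in> interior (V \<inter> A)" using A V by (simp add: interior_open)
      show "sum w (insert i I) \<in> U" if "\<forall>i\<in>insert i I. w i \<in> V \<inter> A" for w
        using that A(3) V(2)[of w] insert.hyps by simp
    qed
  qed
  then show thesis using that by blast
qed

lemma has_sum_Cauchy:
  fixes g :: "'b \<Rightarrow> 'a::topological_ab_group_add"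
  assumes "(g has_sum s) P" "0 \<in> interior U"
  obtains J where "finite J" "J \<subseteq> P" "\<And>C. finite C \<Longrightarrow> C \<subseteq> P - J \<Longrightarrow> sum g C \<in> U"
proof -
  obtain A where A: "closed A" "0 \<in> interior A" "\<And>a. a \<in> A \<Longrightarrow> - a \<in> A"
    "\<And>a b. a \<in> A \<Longrightarrow> b \<in> A \<Longrightarrow> a + b \<in> U"
    using half_nbhd[OF assms(2)] by blast
  have "((\<lambda>J. sum g J - s) \<longlongrightarrow> s - s) (finite_subsets_at_top P)"
    using assms(1) unfolding has_sum_def by (intro tendsto_diff tendsto_const)
  then have "\<forall>\<^sub>F J in finite_subsets_at_top P. sum g J - s \<in> interior A"
    by (rule topological_tendstoD) (use A(2) in simp_all)
  then have "\<exists>J. finite J \<and> J \<subseteq> P \<and> (\<forall>K. finite K \<and> J \<subseteq> K \<and> K \<subseteq> P \<longrightarrow> sum g K - s \<in> interior A)"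
    unfolding eventually_finite_subsets_at_top .
  then obtain J where J: "finite J" "J \<subseteq> P"
    "\<And>K. finite K \<Longrightarrow> J \<subseteq> K \<Longrightarrow> K \<subseteq> P \<Longrightarrow> sum g K - s \<in> interior A"
    by metis
  show thesis
  proof (rule that[OF J(1,2)])
    fix C assume C: "finite C" "C \<subseteq> P - J"
    have "sum g (J \<union> C) = sum g J + sum g C"
      using C J by (intro sum.union_disjoint) auto
    then have "sum g C = (sum g (J \<union> C) - s) + - (sum g J - s)"
      by simp
    moreover have "sum g (J \<union> C) - s \<in> interior A"
      using J(1,2) C by (intro J(3)) auto
    moreover have "sum g J - s \<in> interior A"
      using J(1,2) by (intro J(3)) auto
    ultimately show "sum g C \<in> U" using A(3,4) interior_subset[of A] by (metis subsetD)
  qed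
qed

lemma summable_on_if_Cauchy:
  fixes g :: "'b \<Rightarrow> 'a::real_tvs"
  assumes complete: "tvs_complete TYPE('a)"
    and small: "\<And>U. 0 \<in> interior U \<Longrightarrow>
      \<exists>J. finite J \<and> J \<subseteq> P \<and> (\<forall>C. finite C \<longrightarrow> C \<subseteq> P - J \<longrightarrow> sum g C \<in> U)"
  shows "g summable_on P"
proof -
  let ?T = "finite_subsets_at_top P"
  have "tvs_cauchy_filter (filtermap (sum g) ?T)"
    unfolding tvs_cauchy_filter_def
  proof (rule topological_tendstoI)
    fix S :: "'a set" assume "open S" "0 \<in> S"
    then have "0 \<in> interior S" by (simp add: interior_open)
    then obtain A where A: "closed A" "0 \<in> interior A" "\<And>a. a \<in> A \<Longrightarrow> - a \<in> A"
      "\<And>a b. a \<in> A \<Longrightarrow> b \<in> A \<Longrightarrow> a + b \<in> S"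
      using half_nbhd[of S] by blast
    obtain J where J: "finite J" "J \<subseteq> P" "\<And>C. finite C \<Longrightarrow> C \<subseteq> P - J \<Longrightarrow> sum g C \<in> A"
      using small[OF A(2)] by blast
    have ev: "\<forall>\<^sub>F K in ?T. sum g K \<in> (\<lambda>a. sum g J + a) ` A"
      unfolding eventually_finite_subsets_at_top
    proof (intro exI[of _ J] conjI allI impI)
      fix K assume K: "finite K \<and> J \<subseteq> K \<and> K \<subseteq> P"
      have "sum g K = sum g J + sum g (K - J)"
        using K by (subst sum.subset_diff[of J K]) (auto simp: add.commute)
      then show "sum g K \<in> (\<lambda>a. sum g J + a) ` A"
        using J(3)[of "K - J"] K by blast
    qed (use J in auto)
    have "x - y \<in> S" if xy: "x \<in> (\<lambda>a. sum g J + a) ` A" "y \<in> (\<lambda>a. sum g J + a) ` A" for x y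
    proof -
      obtain a b where "x = sum g J + a" "y = sum g J + b" "a \<in> A" "b \<in> A"
        using xy by blast
      then show ?thesis using A(4)[OF _ A(3)[of b], of a] by simp
    qed
    then show "\<forall>\<^sub>F q in filtermap (sum g) ?T \<times>\<^sub>F filtermap (sum g) ?T. fst q - snd q \<in> S"
      unfolding eventually_prod_filter eventually_filtermap using ev
      by (intro exI[of _ "\<lambda>x. x \<in> (\<lambda>a. sum g J + a) ` A"]) simp
  qed
  moreover have "filtermap (sum g) ?T \<noteq> bot"
    by (simp add: filtermap_bot_iff)
  ultimately obtain l where "filtermap (sum g) ?T \<le> nhds l"
    using complete unfolding tvs_complete_def by blast
  then show ?thesis
    unfolding summable_on_def has_sum_def filterlim_def by blast
qed

section \<open>Vector measures\<close>

locale vector_measure = sigma_algebra \<Omega> H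
  for \<Omega> :: "'w set" and H :: "'w set set" +
  fixes m :: "'w set \<Rightarrow> 'a::{topological_ab_group_add,t2_space}"
  assumes sigma_additive: "sigma_additive H m"
begin

lemma has_sum_disjoint_family:
  "range A \<subseteq> H \<Longrightarrow> disjoint_family A \<Longrightarrow> ((\<lambda>i. m (A i)) has_sum m (\<Union>i. A i)) (UNIV :: nat set)"
  using sigma_additive unfolding sigma_additive_def by blast

text \<open>
  The series with all terms \<open>m {}\<close> converges, and the difference of consecutive partial sums of a
  convergent series tends to \<open>0\<close>.
\<close>

lemma measure_empty: "m {} = 0"
proof -
  have "((\<lambda>i::nat. m {}) has_sum m {}) UNIV"
    using has_sum_disjoint_family[of "\<lambda>_. {}"] by (simp add: disjoint_family_on_def)
  then have lim: "(\<lambda>n. \<Sum>i<n. m {}) \<longlonglongrightarrow> m {}"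
    by (metis has_sum_imp_sums sums_def)
  then have "(\<lambda>n. (\<Sum>i<Suc n. m {}) - (\<Sum>i<n. m {})) \<longlonglongrightarrow> m {} - m {}"
    by (intro tendsto_diff) (rule LIMSEQ_Suc)
  then show ?thesis
    by (simp add: LIMSEQ_const_iff)
qed

text \<open>
  Partitions are sets of sets, whereas \<open>\<sigma>\<close>-additivity speaks of sequences. A countable \<open>P\<close> is
  enumerated along \<open>to_nat_on P\<close> and padded with empty sets, so that finite and infinite partitions
  are treated alike.
\<close>

lemma has_sum_countable:
  assumes "countable P" "P \<subseteq> H" "disjoint P"
  shows "(m has_sum m (\<Union>P)) P"
proof -
  define N where "N = to_nat_on P ` P"
  define A where "A n = (if n \<in> N then from_nat_into P n else {})" for n
  have inj: "inj_on (to_nat_on P) P"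
    using assms(1) by (rule inj_on_to_nat_on)
  have A_to_nat: "A (to_nat_on P \<alpha>) = \<alpha>" if "\<alpha> \<in> P" for \<alpha>
    using that assms(1) by (simp add: A_def N_def)
  have A_cases: "A n = {} \<or> (\<exists>\<alpha>\<in>P. n = to_nat_on P \<alpha> \<and> A n = \<alpha>)" for n
    using A_to_nat by (auto simp: A_def N_def)
  have "range A \<subseteq> H"
    using A_cases assms(2) by (metis empty_sets image_subsetI subsetD)
  moreover have "disjoint_family A"
    unfolding disjoint_family_on_def
  proof (intro ballI impI)
    fix i j :: nat assume "i \<noteq> j"
    then show "A i \<inter> A j = {}"
      using A_cases[of i] A_cases[of j] disjointD[OF assms(3)] by (metis inf_bot_left inf_bot_right)
  qed
  ultimately have "((\<lambda>i. m (A i)) has_sum m (\<Union>i. A i)) UNIV"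
    by (rule has_sum_disjoint_family)
  moreover have "(\<Union>i. A i) = \<Union>P"
  proof
    show "(\<Union>i. A i) \<subseteq> \<Union>P" using A_cases by blast
    show "\<Union>P \<subseteq> (\<Union>i. A i)" using A_to_nat by blast
  qed
  ultimately have "((\<lambda>i. m (A i)) has_sum m (\<Union>P)) UNIV"
    by simp
  also have "?this \<longleftrightarrow> ((\<lambda>i. m (A i)) has_sum m (\<Union>P)) N"
    by (rule has_sum_cong_neutral) (auto simp: A_def measure_empty)
  also have "\<dots> \<longleftrightarrow> ((\<lambda>i. m (A i)) \<circ> to_nat_on P has_sum m (\<Union>P)) P"
    unfolding N_def using inj by (rule has_sum_reindex)
  also have "\<dots> \<longleftrightarrow> (m has_sum m (\<Union>P)) P"
    by (rule has_sum_cong) (simp add: A_to_nat)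
  finally show ?thesis .
qed

lemma measure_Union_finite:
  assumes "finite C" "C \<subseteq> H" "disjoint C"
  shows "m (\<Union>C) = (\<Sum>\<alpha>\<in>C. m \<alpha>)"
  using has_sum_countable[OF countable_finite[OF assms(1)] assms(2,3)]
    has_sum_finite[OF assms(1), of m] has_sum_unique by blast

lemma measure_Un:
  assumes "A \<in> H" "B \<in> H" "A \<inter> B = {}"
  shows "m (A \<union> B) = m A + m B"
proof (cases "A = B")
  case True
  then show ?thesis using assms measure_empty by simp
next
  case False
  then show ?thesis
    using measure_Union_finite[of "{A, B}"] assms by (simp add: pairwise_insert disjnt_def Int_commute)
qed

lemma measure_UN_finite:
  assumes "finite I" "\<And>i. i \<in> I \<Longrightarrow> B i \<in> H" "disjoint_family_on B I"
  shows "m (\<Union>i\<in>I. B i) = (\<Sum>i\<in>I. m (B i))"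
  using assms
proof (induction I)
  case empty
  then show ?case by (simp add: measure_empty)
next
  case (insert i I)
  have "B i \<inter> (\<Union>j\<in>I. B j) = {}"
    using insert.prems(2) insert.hyps by (auto simp: disjoint_family_on_def)
  then have "m (\<Union>j\<in>insert i I. B j) = m (B i) + m (\<Union>j\<in>I. B j)"
    using insert.prems(1) insert.hyps(1) by (simp add: measure_Un finite_UN)
  moreover have "disjoint_family_on B I"
    using insert.prems(2) by (auto simp: disjoint_family_on_def)
  ultimately show ?case
    using insert by simp
qed

lemma tendsto_incseq:
  assumes "range C \<subseteq> H" "incseq C" "E \<in> H"
  shows "(\<lambda>n. m (E \<inter> C n)) \<longlonglongrightarrow> m (E \<inter> (\<Union>n. C n))"
proof -
  define B where "B i = E \<inter> disjointed C i" for i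
  have dH: "disjointed C i \<in> H" for i
    using range_disjointed_sets[OF assms(1)] by blast
  have BH: "B i \<in> H" for i
    using dH assms(3) by (auto simp: B_def)
  have disj: "disjoint_family B"
    using disjoint_family_disjointed[of C] by (auto simp: disjoint_family_on_def B_def)
  have "((\<lambda>i. m (B i)) has_sum m (\<Union>i. B i)) UNIV"
    using BH disj by (intro has_sum_disjoint_family) auto
  moreover have "(\<Union>i. B i) = E \<inter> (\<Union>n. C n)"
    using UN_disjointed_eq[of C] by (auto simp: B_def)
  ultimately have "(\<lambda>n. \<Sum>i<n. m (B i)) \<longlonglongrightarrow> m (E \<inter> (\<Union>n. C n))"
    by (metis has_sum_imp_sums sums_def)
  then have "(\<lambda>n. \<Sum>i<Suc n. m (B i)) \<longlonglongrightarrow> m (E \<inter> (\<Union>n. C n))"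
    by (rule LIMSEQ_Suc)
  moreover have "(\<Sum>i<Suc n. m (B i)) = m (E \<inter> C n)" for n
  proof -
    have "(\<Sum>i<Suc n. m (B i)) = m (\<Union>i<Suc n. B i)"
      using BH disj by (intro measure_UN_finite[symmetric]) (auto simp: disjoint_family_on_def)
    also have "(\<Union>i<Suc n. B i) = E \<inter> (\<Union>i\<in>{0..<Suc n}. disjointed C i)"
      by (auto simp: B_def lessThan_atLeast0)
    also have "\<dots> = E \<inter> C n"
      unfolding finite_UN_disjointed_eq
      using assms(2) by (auto simp: less_Suc_eq_le dest: incseqD)
    finally show ?thesis .
  qed
  ultimately show ?thesis by simp
qed

text \<open>
  Continuity from above at \<open>\<emptyset>\<close>, uniformly over all measurable subsets. If it fails, each tail
  contains a set \<open>E\<close> with \<open>m E \<notin> V\<close>; since \<open>V\<close> is closed, already the part of \<open>E\<close> in some later \<open>C k\<close> has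
  measure outside \<open>V\<close>. Iterating produces a disjoint sequence whose measures do not tend to \<open>0\<close>,
  against \<open>\<sigma>\<close>-additivity.
\<close>

lemma uniform_tail:
  assumes C: "range C \<subseteq> H" "incseq C" and V: "closed V" "0 \<in> interior V"
  shows "\<exists>n. \<forall>E\<in>H. E \<subseteq> (\<Union>i. C i) - C n \<longrightarrow> m E \<in> V"
proof (rule ccontr)
  assume "\<not> ?thesis"
  then have "\<forall>n. \<exists>E. E \<in> H \<and> E \<subseteq> (\<Union>i. C i) - C n \<and> m E \<notin> V"
    by blast
  then obtain E where E: "\<And>n. E n \<in> H" "\<And>n. E n \<subseteq> (\<Union>i. C i) - C n" "\<And>n. m (E n) \<notin> V"
    by metis
  have ex: "\<exists>k>n. m (E n \<inter> C k) \<notin> V" for n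
  proof -
    have "(\<lambda>k. m (E n \<inter> C k)) \<longlonglongrightarrow> m (E n \<inter> (\<Union>i. C i))"
      using C E(1) by (rule tendsto_incseq)
    moreover have "E n \<inter> (\<Union>i. C i) = E n" using E(2) by blast
    ultimately have "\<forall>\<^sub>F k in sequentially. m (E n \<inter> C k) \<in> - V"
      using V(1) E(3)[of n] by (intro topological_tendstoD) auto
    then have "\<forall>\<^sub>F k in sequentially. m (E n \<inter> C k) \<in> - V \<and> n < k"
      using eventually_gt_at_top eventually_conj by blast
    then show ?thesis
      using eventually_happens'[OF sequentially_bot] by fastforce
  qed
  then obtain next_idx where nx: "\<And>n. n < next_idx n" "\<And>n. m (E n \<inter> C (next_idx n)) \<notin> V"
    by metis
  define j where "j i = (next_idx ^^ i) 0" for i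
  have j_Suc: "j (Suc i) = next_idx (j i)" for i by (simp add: j_def)
  have "strict_mono j"
    using nx(1) by (intro strict_monoI_Suc) (simp add: j_Suc)
  define G where "G i = E (j i) \<inter> C (j (Suc i))" for i
  have G: "G i \<in> H" "m (G i) \<notin> V" for i
  proof -
    have "C (j (Suc i)) \<in> H" using C(1) by blast
    with E(1) show "G i \<in> H" unfolding G_def by (rule Int)
    show "m (G i) \<notin> V" unfolding G_def j_Suc by (rule nx(2))
  qed
  have "G i \<inter> G k = {}" if "i < k" for i k
  proof -
    have "j (Suc i) \<le> j k"
      using that \<open>strict_mono j\<close> by (simp add: strict_mono_less_eq)
    then have "C (j (Suc i)) \<subseteq> C (j k)" using C(2) by (simp add: incseqD)
    then show ?thesis using E(2)[of "j k"] by (auto simp: G_def)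
  qed
  then have "disjoint_family G"
    unfolding disjoint_family_on_def by (metis Int_commute linorder_neqE_nat)
  then have "((\<lambda>i. m (G i)) has_sum m (\<Union>i. G i)) UNIV"
    using G(1) by (intro has_sum_disjoint_family) auto
  from has_sum_Cauchy[OF this V(2)]
  obtain J where J: "finite J" "\<And>C. finite C \<Longrightarrow> C \<subseteq> UNIV - J \<Longrightarrow> (\<Sum>i\<in>C. m (G i)) \<in> V"
    by metis
  obtain i where "i \<notin> J" using J(1) ex_new_if_finite infinite_UNIV_nat by blast
  then have "m (G i) \<in> V" using J(2)[of "{i}"] by simp
  then show False using G(2) by blast
qed

end

section \<open>Integrals of simple functions\<close>

locale bilinear_vector_measure = vector_measure \<Omega> H \<mu>
  for \<Omega> :: "'w set" and H :: "'w set set" and \<mu> :: "'w set \<Rightarrow> 'y::{real_tvs,t2_space}" +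
  fixes p :: "'x::{real_tvs,t2_space} \<Rightarrow> 'y \<Rightarrow> 'z::{real_tvs,t2_space}"
    and R :: "'w set set"
  assumes bilinear: "separately_continuous_bilinear p"
    and R_subset: "R \<subseteq> H"
begin

lemma linear_left: "linear (\<lambda>x. p x y)" and linear_right: "linear (p x)"
  using bilinear by (auto simp: separately_continuous_bilinear_def bilinear_def)

lemma p_zero_left [simp]: "p 0 y = 0" and p_zero_right [simp]: "p x 0 = 0"
  using linear_0[OF linear_left] linear_0[OF linear_right] by auto

lemma p_diff_left: "p (x - x') y = p x y - p x' y"
  by (rule linear_diff[OF linear_left])

lemma p_sum_right: "p x (sum g I) = (\<Sum>i\<in>I. p x (g i))"
  by (rule linear_sum[OF linear_right])

lemma p_tendsto_right:
  assumes "(g \<longlongrightarrow> y) F"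
  shows "((\<lambda>i. p x (g i)) \<longlongrightarrow> p x y) F"
proof -
  have "isCont (p x) y"
    using bilinear unfolding separately_continuous_bilinear_def
    by (metis continuous_on_eq_continuous_at open_UNIV UNIV_I)
  then show ?thesis using assms by (rule isCont_tendsto_compose)
qed

lemma p_has_sum_right:
  assumes "(g has_sum y) P"
  shows "((\<lambda>i. p x (g i)) has_sum p x y) P"
  using assms unfolding has_sum_def p_sum_right[symmetric] by (rule p_tendsto_right)

text \<open>
  The integral of a simple function written over its level sets. It depends on \<open>s\<close> alone and so
  identifies the value that every representation of \<open>s\<close> gives.
\<close>

definition level_integral :: "('w \<Rightarrow> 'x) \<Rightarrow> 'w set \<Rightarrow> 'z" where
  "level_integral s A = (\<Sum>v\<in>s ` \<Omega>. p v (\<mu> ({\<omega>\<in>\<Omega>. s \<omega> = v} \<inter> A)))"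

lemma simple_rep_value:
  assumes "simple_rep \<Omega> R s n x B" "\<omega> \<in> \<Omega>"
  shows "i < n \<Longrightarrow> \<omega> \<in> B i \<Longrightarrow> s \<omega> = x i"
    and "(\<And>i. i < n \<Longrightarrow> \<omega> \<notin> B i) \<Longrightarrow> s \<omega> = 0"
proof -
  have s: "s \<omega> = (\<Sum>i<n. indicat_real (B i) \<omega> *\<^sub>R x i)"
    and disj: "disjoint_family_on B {..<n}"
    using assms by (auto simp: simple_rep_def)
  show "s \<omega> = x i" if i: "i < n" "\<omega> \<in> B i"
  proof -
    have "\<omega> \<notin> B k" if "k < n" "k \<noteq> i" for k
      using disj i that by (auto simp: disjoint_family_on_def)
    then have "s \<omega> = (\<Sum>k<n. if k = i then x i else 0)"
      unfolding s using i by (intro sum.cong) auto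
    then show ?thesis using i by simp
  qed
  show "s \<omega> = 0" if "\<And>i. i < n \<Longrightarrow> \<omega> \<notin> B i"
    unfolding s using that by (intro sum.neutral) auto
qed

lemma simple_fun_levels:
  assumes "simple_fun \<Omega> R s"
  shows "finite (s ` \<Omega>)" and "{\<omega>\<in>\<Omega>. s \<omega> = v} \<in> H"
proof -
  obtain n x B where rep: "simple_rep \<Omega> R s n x B"
    using assms by (auto simp: simple_fun_def)
  have BH: "B i \<in> H" if "i < n" for i
    using rep that R_subset by (auto simp: simple_rep_def)
  note val = simple_rep_value[OF rep]
  have "s ` \<Omega> \<subseteq> insert 0 (x ` {..<n})"
    using val by blast
  then show "finite (s ` \<Omega>)" by (rule finite_subset) simp
  show "{\<omega>\<in>\<Omega>. s \<omega> = v} \<in> H"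
  proof (cases "v = 0")
    case True
    have "{\<omega>\<in>\<Omega>. s \<omega> = 0} = \<Omega> - (\<Union>i\<in>{i. i < n \<and> x i \<noteq> 0}. B i)"
      using val by (auto, metis)
    moreover have "(\<Union>i\<in>{i. i < n \<and> x i \<noteq> 0}. B i) \<in> H"
      using BH by (intro finite_UN) auto
    ultimately show ?thesis using True by auto
  next
    case False
    have "{\<omega>\<in>\<Omega>. s \<omega> = v} = (\<Union>i\<in>{i. i < n \<and> x i = v}. B i)"
    proof
      show "{\<omega>\<in>\<Omega>. s \<omega> = v} \<subseteq> (\<Union>i\<in>{i. i < n \<and> x i = v}. B i)"
        using val False by (smt (verit) UN_I mem_Collect_eq subsetI)
      show "(\<Union>i\<in>{i. i < n \<and> x i = v}. B i) \<subseteq> {\<omega>\<in>\<Omega>. s \<omega> = v}"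
        using val(1) BH sets_into_space by blast
    qed
    moreover have "(\<Union>i\<in>{i. i < n \<and> x i = v}. B i) \<in> H"
      using BH by (intro finite_UN) auto
    ultimately show ?thesis by simp
  qed
qed

text \<open>
  Each \<open>B i\<close> is inside the level set of its coefficient, so it may be cut by all level sets and the
  sums interchanged; a level set of a nonzero value is the union of the pieces found in it.
\<close>

lemma simple_rep_integral:
  assumes rep: "simple_rep \<Omega> R s n x B" and A: "A \<in> H"
  shows "(\<Sum>i<n. p (x i) (\<mu> (B i \<inter> A))) = level_integral s A"
proof -
  let ?L = "\<lambda>v. {\<omega>\<in>\<Omega>. s \<omega> = v}"
  have BH: "B i \<in> H" if "i < n" for i
    using rep that R_subset by (auto simp: simple_rep_def)
  note val = simple_rep_value[OF rep]
  have disj: "disjoint_family_on B {..<n}" using rep by (simp add: simple_rep_def)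
  have simple: "simple_fun \<Omega> R s" using rep by (auto simp: simple_fun_def)
  note levels = simple_fun_levels[OF simple]
  have "p (x i) (\<mu> (B i \<inter> A)) = (\<Sum>v\<in>s ` \<Omega>. p v (\<mu> (?L v \<inter> B i \<inter> A)))" if i: "i < n" for i
  proof (cases "B i = {}")
    case True
    then show ?thesis by (simp add: measure_empty)
  next
    case False
    have sub: "B i \<subseteq> \<Omega>" using BH[OF i] sets_into_space by blast
    then have eq: "?L v \<inter> B i = (if v = x i then B i else {})" for v
      using val(1) i by auto
    obtain \<omega> where "\<omega> \<in> B i" using False by blast
    then have "x i = s \<omega>" "\<omega> \<in> \<Omega>" using val(1)[of \<omega> i] sub i by auto
    then have "x i \<in> s ` \<Omega>" by blast
    moreover have "(\<Sum>v\<in>s ` \<Omega>. p v (\<mu> (?L v \<inter> B i \<inter> A))) =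
        (\<Sum>v\<in>s ` \<Omega>. if v = x i then p (x i) (\<mu> (B i \<inter> A)) else 0)"
      unfolding eq by (intro sum.cong) (auto simp: measure_empty)
    ultimately show ?thesis using levels(1) by simp
  qed
  then have "(\<Sum>i<n. p (x i) (\<mu> (B i \<inter> A))) = (\<Sum>i<n. \<Sum>v\<in>s ` \<Omega>. p v (\<mu> (?L v \<inter> B i \<inter> A)))"
    by simp
  also have "\<dots> = (\<Sum>v\<in>s ` \<Omega>. \<Sum>i<n. p v (\<mu> (?L v \<inter> B i \<inter> A)))"
    by (rule sum.swap)
  also have "\<dots> = (\<Sum>v\<in>s ` \<Omega>. p v (\<mu> (?L v \<inter> A)))"
  proof (rule sum.cong[OF refl])
    fix v
    show "(\<Sum>i<n. p v (\<mu> (?L v \<inter> B i \<inter> A))) = p v (\<mu> (?L v \<inter> A))"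
    proof (cases "v = 0")
      case False
      have "(\<Sum>i<n. \<mu> (?L v \<inter> B i \<inter> A)) = \<mu> (\<Union>i<n. ?L v \<inter> B i \<inter> A)"
      proof (rule measure_UN_finite[symmetric])
        show "disjoint_family_on (\<lambda>i. ?L v \<inter> B i \<inter> A) {..<n}"
          using disj unfolding disjoint_family_on_def by blast
      qed (use levels(2) BH A in auto)
      also have "(\<Union>i<n. ?L v \<inter> B i \<inter> A) = ?L v \<inter> A"
        using val(2) False by auto
      finally show ?thesis by (simp add: p_sum_right[symmetric])
    qed simp
  qed
  finally show ?thesis by (simp add: level_integral_def)
qed

lemma simple_fun_integral_eq:
  assumes "simple_fun \<Omega> R s" "A \<in> H"
  shows "simple_fun_integral p \<Omega> R \<mu> A s = level_integral s A"
  unfolding simple_fun_integral_def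
  using assms simple_rep_integral[OF _ assms(2), of s]
  by (intro the_equality) (auto simp: simple_fun_def, metis)

lemma level_integral_sigma_additive:
  assumes s: "simple_fun \<Omega> R s"
  shows "vector_measure \<Omega> H (level_integral s)"
proof
  show "sigma_additive H (level_integral s)"
    unfolding sigma_additive_def
  proof (intro allI impI)
    fix A :: "nat \<Rightarrow> 'w set" assume A: "range A \<subseteq> H" "disjoint_family A"
    have AH: "A i \<in> H" for i using A(1) by blast
    have summand: "((\<lambda>i. p v (\<mu> ({\<omega>\<in>\<Omega>. s \<omega> = v} \<inter> A i))) has_sum
        p v (\<mu> ({\<omega>\<in>\<Omega>. s \<omega> = v} \<inter> (\<Union>i. A i)))) UNIV" for v
    proof -
      have "((\<lambda>i. \<mu> ({\<omega>\<in>\<Omega>. s \<omega> = v} \<inter> A i)) has_sum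
          \<mu> (\<Union>i. {\<omega>\<in>\<Omega>. s \<omega> = v} \<inter> A i)) UNIV"
        using A(2) Int[OF simple_fun_levels(2)[OF s] AH]
        by (intro has_sum_disjoint_family) (auto simp: disjoint_family_on_def)
      then show ?thesis
        by (simp add: p_has_sum_right)
    qed
    have "((\<lambda>i. \<Sum>v\<in>V. p v (\<mu> ({\<omega>\<in>\<Omega>. s \<omega> = v} \<inter> A i))) has_sum
        (\<Sum>v\<in>V. p v (\<mu> ({\<omega>\<in>\<Omega>. s \<omega> = v} \<inter> (\<Union>i. A i))))) UNIV" if "finite V" for V
      using that
    proof (induction V)
      case (insert v V)
      then show ?case using has_sum_add[OF summand[of v]] by simp
    qed simp
    then show "((\<lambda>i. level_integral s (A i)) has_sum level_integral s (\<Union>i. A i)) UNIV"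
      unfolding level_integral_def using simple_fun_levels(1)[OF s] by blast
  qed
qed

lemma level_integral_const:
  assumes s: "simple_fun \<Omega> R s" and "\<alpha> \<subseteq> \<Omega>" "\<omega> \<in> \<alpha>" "\<And>\<omega>'. \<omega>' \<in> \<alpha> \<Longrightarrow> s \<omega>' = s \<omega>"
  shows "level_integral s \<alpha> = p (s \<omega>) (\<mu> \<alpha>)"
proof -
  have "{\<omega>'\<in>\<Omega>. s \<omega>' = v} \<inter> \<alpha> = (if v = s \<omega> then \<alpha> else {})" for v
  proof -
    have "\<omega>' \<in> \<Omega> \<and> s \<omega>' = s \<omega>" if "\<omega>' \<in> \<alpha>" for \<omega>'
      using assms(2,4) that by blast
    then show ?thesis by (simp add: set_eq_iff) metis
  qed
  then have "level_integral s \<alpha> = (\<Sum>v\<in>s ` \<Omega>. if v = s \<omega> then p (s \<omega>) (\<mu> \<alpha>) else 0)"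
    unfolding level_integral_def by (intro sum.cong) (auto simp: measure_empty)
  then show ?thesis
    using simple_fun_levels(1)[OF s] assms(2,3) by (simp add: subset_iff)
qed

end

section \<open>Control submeasures and null sets\<close>

text \<open>
  The coverings that witness small outer values \<open>\<xi> (E g)\<close> depend on \<open>\<xi>\<close>. Smallness of \<open>\<eta>\<close> is
  enforced by smallness of finitely many \<open>\<xi> \<in> S\<close>, and the intersection of their coverings is a
  covering that is small for all of them.
\<close>

lemma control_cover:
  assumes H: "sigma_algebra \<Omega> H" and control: "control_submeasure H S \<eta>"
    and submeasure: "\<forall>\<xi>\<in>S. submeasure H \<xi>"
    and lim: "\<And>\<xi>. \<xi> \<in> S \<Longrightarrow> ((\<lambda>g. submeasure_ext H \<xi> (E g)) \<longlongrightarrow> 0) F"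
    and E: "\<And>g. E g \<subseteq> \<Omega>" and e: "0 < e"
  shows "\<forall>\<^sub>F g in F. \<exists>A\<in>H. E g \<subseteq> A \<and> \<eta> A \<le> ennreal e"
proof -
  interpret sigma_algebra \<Omega> H by (rule H)
  \<comment> \<open>The coarsest filter on \<open>H\<close> along which every \<open>\<xi> \<in> S\<close> tends to \<open>0\<close>.\<close>
  define G where "G = inf (INF \<xi>\<in>S. filtercomap \<xi> (nhds 0)) (principal H)"
  have "(\<xi> \<longlongrightarrow> 0) G" if "\<xi> \<in> S" for \<xi>
    unfolding filterlim_iff_le_filtercomap G_def
    using that by (intro le_infI1 INF_lower)
  moreover have "G \<le> principal H" by (simp add: G_def)
  ultimately have "(\<eta> \<longlongrightarrow> 0) G"
    using control unfolding control_submeasure_def by blast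
  then have "\<forall>\<^sub>F A in G. \<eta> A < ennreal e"
    using e by (intro order_tendstoD) auto
  then have "\<forall>\<^sub>F A in INF \<xi>\<in>S. filtercomap \<xi> (nhds 0). A \<in> H \<longrightarrow> \<eta> A < ennreal e"
    by (simp add: G_def eventually_inf_principal)
  then obtain S0 where S0: "S0 \<subseteq> S" "finite S0"
    and "\<forall>\<^sub>F A in INF \<xi>\<in>S0. filtercomap \<xi> (nhds 0). A \<in> H \<longrightarrow> \<eta> A < ennreal e"
    unfolding eventually_INF[of _ _ S] by (elim exE conjE) (rule that)
  then obtain Q where Q: "\<forall>\<xi>\<in>S0. eventually (Q \<xi>) (filtercomap \<xi> (nhds 0))"
    "\<forall>A. (\<forall>\<xi>\<in>S0. Q \<xi> A) \<longrightarrow> A \<in> H \<longrightarrow> \<eta> A < ennreal e"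
    unfolding eventually_INF_finite[OF S0(2)] by (elim exE conjE) (rule that)
  have "\<exists>d>0. \<forall>A. \<xi> A < d \<longrightarrow> Q \<xi> A" if \<xi>: "\<xi> \<in> S0" for \<xi>
  proof -
    obtain P where P: "eventually P (nhds 0)" "\<And>A. P (\<xi> A) \<Longrightarrow> Q \<xi> A"
      using bspec[OF Q(1) \<xi>] unfolding eventually_filtercomap by metis
    then obtain U where U: "open U" "0 \<in> U" "\<And>x. x \<in> U \<Longrightarrow> P x"
      unfolding eventually_nhds by metis
    obtain b where "0 < b" "{0..<b} \<subseteq> U"
      using open_right[OF U(1,2), of 1] by auto
    then show ?thesis using U(3) P(2) by (intro exI[of _ b]) auto
  qed
  then obtain d where d: "\<And>\<xi>. \<xi> \<in> S0 \<Longrightarrow> 0 < d \<xi>" "\<And>\<xi> A. \<xi> \<in> S0 \<Longrightarrow> \<xi> A < d \<xi> \<Longrightarrow> Q \<xi> A"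
    by metis
  have "\<forall>\<^sub>F g in F. \<forall>\<xi>\<in>S0. submeasure_ext H \<xi> (E g) < d \<xi>"
    using S0 d(1) lim by (intro eventually_ball_finite ballI order_tendstoD(2)[OF lim]) auto
  then show ?thesis
  proof (rule eventually_mono)
    fix g assume g: "\<forall>\<xi>\<in>S0. submeasure_ext H \<xi> (E g) < d \<xi>"
    have "\<exists>A\<in>H. E g \<subseteq> A \<and> \<xi> A < d \<xi>" if "\<xi> \<in> S0" for \<xi>
      using g that by (auto simp: submeasure_ext_def INF_less_iff)
    then obtain A where A: "\<And>\<xi>. \<xi> \<in> S0 \<Longrightarrow> A \<xi> \<in> H \<and> E g \<subseteq> A \<xi> \<and> \<xi> (A \<xi>) < d \<xi>"
      by metis
    define B where "B = \<Omega> \<inter> (\<Inter>\<xi>\<in>S0. A \<xi>)"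
    have B: "B \<in> H"
    proof (cases "S0 = {}")
      case False
      then have "(\<Inter>\<xi>\<in>S0. A \<xi>) \<in> H" using A S0(2) by (intro finite_INT) auto
      then show ?thesis by (auto simp: B_def)
    qed (simp add: B_def)
    have "Q \<xi> B" if "\<xi> \<in> S0" for \<xi>
    proof (rule d(2)[OF that])
      have "\<xi> B \<le> \<xi> (A \<xi>)"
        using submeasure S0(1) that A[OF that] B unfolding submeasure_def B_def
        by (metis INT_lower IntE subsetD subsetI)
      then show "\<xi> B < d \<xi>" using A[OF that] by (meson le_less_trans)
    qed
    then have "\<eta> B < ennreal e" using Q(2) B by blast
    moreover have "E g \<subseteq> B" using E[of g] A by (auto simp: B_def)
    ultimately show "\<exists>A\<in>H. E g \<subseteq> A \<and> \<eta> A \<le> ennreal e"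
      using B by (intro bexI[of _ B]) (auto intro: less_imp_le)
  qed
qed

lemma submeasure_Un_le:
  "submeasure H \<eta> \<Longrightarrow> A \<in> H \<Longrightarrow> B \<in> H \<Longrightarrow> \<eta> A \<le> a \<Longrightarrow> \<eta> B \<le> b \<Longrightarrow> \<eta> (A \<union> B) \<le> a + b"
  unfolding submeasure_def by (meson add_mono order_trans)

lemma control_cover_finite:
  assumes H: "sigma_algebra \<Omega> H" and control: "control_submeasure H S \<eta>"
    and submeasure: "\<forall>\<xi>\<in>S. submeasure H \<xi>"
    and "finite I"
    and "\<And>\<xi> i. \<xi> \<in> S \<Longrightarrow> i \<in> I \<Longrightarrow> ((\<lambda>g. submeasure_ext H \<xi> (E i g)) \<longlongrightarrow> 0) F"
    and E: "\<And>i g. E i g \<subseteq> \<Omega>" and "0 < e"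
  shows "\<forall>\<^sub>F g in F. \<exists>A\<in>H. (\<Union>i\<in>I. E i g) \<subseteq> A \<and> \<eta> A \<le> ennreal e"
  using assms(4,5,7)
proof (induction I arbitrary: e)
  case empty
  interpret sigma_algebra \<Omega> H by (rule H)
  have "\<eta> {} = 0" using control by (simp add: control_submeasure_def submeasure_def)
  then show ?case by (intro always_eventually allI bexI[of _ "{}"]) auto
next
  case (insert i I)
  interpret sigma_algebra \<Omega> H by (rule H)
  have "\<forall>\<^sub>F g in F. \<exists>A\<in>H. E i g \<subseteq> A \<and> \<eta> A \<le> ennreal (e / 2)"
    using insert.prems E by (intro control_cover[OF H control submeasure]) auto
  moreover have "\<forall>\<^sub>F g in F. \<exists>A\<in>H. (\<Union>i\<in>I. E i g) \<subseteq> A \<and> \<eta> A \<le> ennreal (e / 2)"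
    using insert.prems by (intro insert.IH) auto
  ultimately show ?case
  proof eventually_elim
    case (elim g)
    then obtain A B where AB: "A \<in> H" "E i g \<subseteq> A" "\<eta> A \<le> ennreal (e / 2)"
      "B \<in> H" "(\<Union>i\<in>I. E i g) \<subseteq> B" "\<eta> B \<le> ennreal (e / 2)" by blast
    have "\<eta> (A \<union> B) \<le> ennreal (e / 2) + ennreal (e / 2)"
      using control AB by (intro submeasure_Un_le) (auto simp: control_submeasure_def)
    also have "\<dots> = ennreal e"
      using insert.prems(2) by (simp flip: ennreal_plus)
    finally show ?case using AB by (intro bexI[of _ "A \<union> B"]) auto
  qed
qed

lemma submeasure_geometric_union:
  assumes H: "sigma_algebra \<Omega> H" and \<eta>: "submeasure H \<eta>"
    and E: "\<And>n. E n \<in> H" "\<And>n. \<eta> (E n) \<le> ennreal (1 / 2 ^ n)"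
  shows "\<eta> (\<Union>n\<in>{k..<k + l}. E n) \<le> ennreal (2 / 2 ^ k)"
proof (induction l arbitrary: k)
  case 0
  then show ?case using \<eta> by (simp add: submeasure_def)
next
  case (Suc l)
  interpret sigma_algebra \<Omega> H by (rule H)
  have "{k..<k + Suc l} = insert k {Suc k..<Suc k + l}" by auto
  then have "(\<Union>n\<in>{k..<k + Suc l}. E n) = E k \<union> (\<Union>n\<in>{Suc k..<Suc k + l}. E n)" by simp
  also have "\<eta> \<dots> \<le> ennreal (1 / 2 ^ k) + ennreal (2 / 2 ^ Suc k)"
    using E Suc.IH[of "Suc k"] by (intro submeasure_Un_le[OF \<eta>]) auto
  also have "\<dots> = ennreal (2 / 2 ^ k)"
    by (simp flip: ennreal_plus)
  finally show ?case .
qed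

locale masse_setting = bilinear_vector_measure \<Omega> H \<mu> p R
  for \<Omega> :: "'w set" and H :: "'w set set" and \<mu> :: "'w set \<Rightarrow> 'y::{real_tvs,t2_space}"
    and p :: "'x::{real_tvs,t2_space} \<Rightarrow> 'y \<Rightarrow> 'z::{real_tvs,t2_space}" and R :: "'w set set" +
  fixes S :: "('w set \<Rightarrow> ennreal) set" and \<eta> :: "'w set \<Rightarrow> ennreal"
  assumes submeasures: "\<forall>\<xi>\<in>S. submeasure H \<xi>"
    and control: "control_submeasure H S \<eta>"
    and null_integrable: "\<forall>E\<in>H. (\<forall>\<xi>\<in>S. \<xi> E = 0) \<longrightarrow> E \<in> R"
    and M2: "masse_M2 p R S \<mu>"
    and metrizable_Y: "metrizable_space (euclidean :: 'y topology)"
begin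

lemma submeasure_control: "submeasure H \<eta>"
  using control by (simp add: control_submeasure_def)

lemma control_mono: "A \<in> H \<Longrightarrow> B \<in> H \<Longrightarrow> A \<subseteq> B \<Longrightarrow> \<eta> A \<le> \<eta> B"
  using submeasure_control by (simp add: submeasure_def)

text \<open>
  Along the principal filter of a single \<open>\<eta>\<close>-null set every \<open>\<xi> \<in> S\<close> tends to \<open>0\<close>. This puts the set in
  \<open>R\<close> and makes the continuity hypothesis on \<open>x\<mu>\<close> applicable to it.
\<close>

lemma control_null:
  assumes "E \<in> H" "\<eta> E = 0" "A \<in> H" "A \<subseteq> E"
  shows "p x (\<mu> A) = 0"
proof -
  let ?F = "principal {A}"
  have eq: "g A = 0" if "(g \<longlongrightarrow> 0) ?F" for g :: "'w set \<Rightarrow> 'b::{t2_space,zero}"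
    using tendsto_unique[OF _ tendsto_principal_singleton[of g A] that]
    by (simp add: principal_eq_bot_iff)
  have "\<eta> A = 0" using control_mono[OF assms(3,1,4)] assms(2) by simp
  then have "(\<eta> \<longlongrightarrow> 0) ?F" using tendsto_principal_singleton[of \<eta> A] by simp
  moreover have "?F \<le> principal H" using assms(3) by simp
  ultimately have null: "\<forall>\<xi>\<in>S. (\<xi> \<longlongrightarrow> 0) ?F"
    using control unfolding control_submeasure_def by blast
  then have "A \<in> R" using null_integrable assms(3) eq by blast
  then have "((\<lambda>E. p x (\<mu> E)) \<longlongrightarrow> 0) ?F"
    using M2 null unfolding masse_M2_def by simp
  then show ?thesis by (rule eq)
qed

text \<open>
  A submeasure is only finitely subadditive, so the limes superior \<open>N\<close> of the sets \<open>E n\<close> need not be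
  small for \<open>\<eta>\<close>, and a Borel--Cantelli argument has to use the \<open>\<sigma>\<close>-additivity of \<open>\<mu>\<close> as well. Finite
  unions \<open>U k l\<close> of the \<open>E n\<close> do have \<open>\<eta>\<close>-value at most \<open>2\<^sup>1\<^sup>-\<^sup>k\<close>. Take \<open>l k\<close> so large that \<open>\<mu>\<close> is in
  \<open>V (k + 1)\<close> on all subsets of \<open>N - U k (l k)\<close>. Then \<open>T j = (\<Inter>k\<ge>j. U k (l k))\<close> is \<open>\<eta>\<close>-null, hence an
  integrable set on which all \<open>x\<mu>\<close> vanish. A set in \<open>N\<close> outside every \<open>T j\<close> splits, for each \<open>j\<close>, into
  pieces of measure in \<open>V (k + 1)\<close>, \<open>k \<ge> j\<close>, and so has \<open>\<mu>\<close>-measure \<open>0\<close>.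
\<close>

lemma limsup_null:
  assumes E: "\<And>n. E n \<in> H" "\<And>n. \<eta> (E n) \<le> ennreal (1 / 2 ^ n)"
    and A: "A \<in> H" "A \<subseteq> (\<Inter>k. \<Union>n\<in>{k..}. E n)"
  shows "p x (\<mu> A) = 0"
proof -
  obtain V :: "nat \<Rightarrow> 'y set" where V: "zero_chain V"
    using zero_chain_exists[OF metrizable_Y] by blast
  interpret V: zero_chain V by (rule V)
  define U where "U k l = (\<Union>n\<in>{k..<k + l}. E n)" for k l
  have UH: "U k l \<in> H" for k l
    using E(1) by (auto simp: U_def)
  have U_Un: "(\<Union>l. U k l) = (\<Union>n\<in>{k..}. E n)" for k
  proof -
    have "(\<Union>l. {k..<k + l}) = {k..}"
      using less_add_Suc2 by (force dest: le_Suc_ex)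
    then show ?thesis unfolding U_def by blast
  qed
  have "\<exists>l. \<forall>B\<in>H. B \<subseteq> (\<Union>l. U k l) - U k l \<longrightarrow> \<mu> B \<in> V (Suc k)" for k
  proof (rule uniform_tail)
    show "incseq (U k)"
      unfolding U_def by (intro incseq_SucI UN_mono) auto
  qed (use UH V.closed_W V.zero_W in auto)
  then obtain l where l: "\<And>k B. B \<in> H \<Longrightarrow> B \<subseteq> (\<Union>l. U k l) - U k (l k) \<Longrightarrow> \<mu> B \<in> V (Suc k)"
    by metis
  define T where "T j = (\<Inter>k\<in>{j..}. U k (l k))" for j
  have TH: "T j \<in> H" for j
    unfolding T_def using UH by (intro countable_INT') auto
  have "\<eta> (T j) \<le> ennreal (2 / 2 ^ k)" if "j \<le> k" for j k
  proof -
    have "\<eta> (T j) \<le> \<eta> (U k (l k))"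
      using that TH UH by (intro control_mono) (auto simp: T_def)
    also have "\<dots> \<le> ennreal (2 / 2 ^ k)"
      unfolding U_def using E by (rule submeasure_geometric_union[OF sigma_algebra_axioms submeasure_control])
    finally show ?thesis .
  qed
  moreover have "(\<lambda>k. ennreal (2 / 2 ^ k)) \<longlonglongrightarrow> ennreal 0"
    by (intro tendsto_ennrealI LIMSEQ_divide_realpow_zero) simp
  ultimately have "\<eta> (T j) \<le> ennreal 0" for j
    by (intro LIMSEQ_le_const) auto
  then have T_null: "\<eta> (T j) = 0" for j by simp
  have "p x (\<mu> (A \<inter> T j)) = 0" for j
    using A(1) TH by (intro control_null[OF TH T_null]) auto
  moreover have "(\<lambda>j. p x (\<mu> (A \<inter> T j))) \<longlonglongrightarrow> p x (\<mu> (A \<inter> (\<Union>j. T j)))"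
  proof (intro p_tendsto_right tendsto_incseq)
    show "incseq T"
      unfolding T_def by (intro incseq_SucI INT_anti_mono) auto
  qed (use TH A in auto)
  ultimately have inside: "p x (\<mu> (A \<inter> (\<Union>j. T j))) = 0"
    by (simp add: LIMSEQ_const_iff)
  define A' where "A' = A - (\<Union>j. T j)"
  have UTH: "(\<Union>j. T j) \<in> H" using TH by blast
  then have A'H: "A' \<in> H" unfolding A'_def using A(1) by blast
  have "\<mu> A' \<in> V j" for j
  proof -
    define B where "B i = A' - U (j + i) (l (j + i))" for i
    have BH: "range B \<subseteq> H" unfolding B_def using A'H UH by blast
    have dH: "disjointed B i \<in> H" for i
      using range_disjointed_sets[OF BH] by blast
    have "(\<Union>i. B i) = A'"
    proof
      show "(\<Union>i. B i) \<subseteq> A'" by (auto simp: B_def)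
      show "A' \<subseteq> (\<Union>i. B i)"
      proof
        fix \<omega> assume \<omega>: "\<omega> \<in> A'"
        then have "\<omega> \<notin> T j" by (simp add: A'_def)
        then obtain k where "j \<le> k" "\<omega> \<notin> U k (l k)" by (auto simp: T_def)
        then have "\<omega> \<in> B (k - j)" using \<omega> by (simp add: B_def)
        then show "\<omega> \<in> (\<Union>i. B i)" by blast
      qed
    qed
    then have "(\<Union>i. disjointed B i) = A'" by (simp add: UN_disjointed_eq)
    moreover have "((\<lambda>i. \<mu> (disjointed B i)) has_sum \<mu> (\<Union>i. disjointed B i)) UNIV"
      using dH disjoint_family_disjointed by (intro has_sum_disjoint_family) auto
    ultimately have "(\<lambda>n. \<Sum>i<n. \<mu> (disjointed B i)) \<longlonglongrightarrow> \<mu> A'"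
      by (metis has_sum_imp_sums sums_def)
    moreover have "(\<Sum>i<n. \<mu> (disjointed B i)) \<in> V j" for n
    proof -
      have small: "\<mu> (disjointed B i) \<in> V (Suc (j + i))" for i
      proof (rule l[OF dH])
        show "disjointed B i \<subseteq> (\<Union>l. U (j + i) l) - U (j + i) (l (j + i))"
          using disjointed_subset[of B i] A(2) unfolding U_Un by (auto simp: B_def A'_def)
      qed
      have "(\<Sum>i\<in>{j..<j + n}. \<mu> (disjointed B (i - j))) \<in> V j"
      proof (rule V.sum_interval_W)
        fix i assume "j \<le> i"
        then show "\<mu> (disjointed B (i - j)) \<in> V (Suc i)" using small[of "i - j"] by simp
      qed
      moreover have "(\<Sum>i\<in>{j..<j + n}. \<mu> (disjointed B (i - j))) = (\<Sum>i<n. \<mu> (disjointed B i))"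
        using sum.shift_bounds_nat_ivl[of "\<lambda>i. \<mu> (disjointed B (i - j))" 0 j n]
        by (simp add: lessThan_atLeast0 add.commute)
      ultimately show ?thesis by simp
    qed
    ultimately show ?thesis
      by (intro Lim_in_closed_set[OF V.closed_W always_eventually sequentially_bot]) auto
  qed
  then have outside: "\<mu> A' = 0" by (rule zero_chain_separates[OF V])
  have "\<mu> A = \<mu> (A \<inter> (\<Union>j. T j)) + \<mu> A'"
  proof -
    have "A = (A \<inter> (\<Union>j. T j)) \<union> A'" by (auto simp: A'_def)
    moreover have "\<mu> ((A \<inter> (\<Union>j. T j)) \<union> A') = \<mu> (A \<inter> (\<Union>j. T j)) + \<mu> A'"
    proof (rule measure_Un)
      show "A \<inter> (\<Union>j. T j) \<in> H" using A(1) UTH by (rule Int)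
    qed (use A'H in \<open>auto simp: A'_def\<close>)
    ultimately show ?thesis by simp
  qed
  then show ?thesis using inside outside by simp
qed

end

section \<open>The indefinite integral\<close>

text \<open>
  A neighbourhood of \<open>0\<close> only involves finitely many seminorms, so convergence in submeasure, which
  is stated seminorm by seminorm, controls membership in a neighbourhood.
\<close>

lemma seminorm_nbhd:
  fixes U :: "'x::real_tvs set"
  assumes D: "defining_F_seminorms D" and U: "0 \<in> interior U"
  obtains D0 e where "finite D0" "D0 \<subseteq> D" "\<forall>d\<in>D0. 0 < e d" "{x. \<forall>d\<in>D0. d x < e d} \<subseteq> U"
proof -
  let ?G = "\<lambda>d::'x \<Rightarrow> real. INF e\<in>{0<..}. principal {x. d x < e}"
  have "\<forall>\<^sub>F x in INF d\<in>D. ?G d. x \<in> U"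
    using D U unfolding zero_interior_iff_eventually defining_F_seminorms_def by metis
  then obtain D0 where D0: "D0 \<subseteq> D" "finite D0" and "\<forall>\<^sub>F x in INF d\<in>D0. ?G d. x \<in> U"
    unfolding eventually_INF[of _ _ D] by (elim exE conjE) (rule that)
  then obtain Q where Q: "\<forall>d\<in>D0. eventually (Q d) (?G d)" "\<forall>x. (\<forall>d\<in>D0. Q d x) \<longrightarrow> x \<in> U"
    unfolding eventually_INF_finite[OF D0(2)] by (elim exE conjE) (rule that)
  have "\<exists>e>0. \<forall>x. d x < e \<longrightarrow> Q d x" if "d \<in> D0" for d
  proof -
    have "eventually (Q d) (?G d)" using Q(1) that by blast
    also have "eventually (Q d) (?G d) \<longleftrightarrow>
        (\<exists>e\<in>{0<..}. eventually (Q d) (principal {x. d x < e}))"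
    proof (rule eventually_INF_base)
      fix a b :: real assume "a \<in> {0<..}" "b \<in> {0<..}"
      then show "\<exists>x\<in>{0<..}. principal {y. d y < x} \<le> inf (principal {x. d x < a}) (principal {x. d x < b})"
        by (intro bexI[of _ "min a b"]) auto
    qed auto
    finally show ?thesis by (auto simp: eventually_principal)
  qed
  then obtain e where e: "\<And>d. d \<in> D0 \<Longrightarrow> 0 < e d \<and> (\<forall>x. d x < e d \<longrightarrow> Q d x)"
    by metis
  show thesis
  proof (rule that[OF D0(2,1)])
    show "\<forall>d\<in>D0. 0 < e d" using e by blast
    show "{x. \<forall>d\<in>D0. d x < e d} \<subseteq> U" using e Q(2) by blast
  qed
qed

locale masse_integrand = masse_setting \<Omega> H \<mu> p R S \<eta>
  for \<Omega> :: "'w set" and H :: "'w set set" and \<mu> :: "'w set \<Rightarrow> 'y::{real_tvs,t2_space}"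
    and p :: "'x::{real_tvs,t2_space} \<Rightarrow> 'y \<Rightarrow> 'z::{real_tvs,t2_space}" and R :: "'w set set"
    and S :: "('w set \<Rightarrow> ennreal) set" and \<eta> :: "'w set \<Rightarrow> ennreal" +
  fixes D :: "('x \<Rightarrow> real) set" and F :: "('w \<Rightarrow> 'x) filter" and f :: "'w \<Rightarrow> 'x"
  assumes complete_Z: "tvs_complete TYPE('z)"
    and metrizable_Z: "metrizable_space (euclidean :: 'z topology)"
    and seminorms: "defining_F_seminorms D"
    and semivariation: "finite_semivariation p H \<mu>"
    and approx: "masse_approx p \<Omega> H S D R \<mu> F f"
begin

lemma F_nonbot: "F \<noteq> bot"
  using approx by (simp add: masse_approx_def)

lemma eventually_simple: "\<forall>\<^sub>F s in F. simple_fun \<Omega> R s"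
  using approx by (auto simp: masse_approx_def le_principal)

lemma approx_Cauchy:
  assumes "0 \<in> interior W"
  shows "\<forall>\<^sub>F q in F \<times>\<^sub>F F. \<forall>A\<in>H. level_integral (fst q) A - level_integral (snd q) A \<in> W"
proof -
  have "\<forall>\<^sub>F q in F \<times>\<^sub>F F. \<forall>A\<in>H.
      simple_fun_integral p \<Omega> R \<mu> A (fst q) - simple_fun_integral p \<Omega> R \<mu> A (snd q) \<in> W"
    using approx assms by (simp add: masse_approx_def)
  moreover have "\<forall>\<^sub>F q in F \<times>\<^sub>F F. simple_fun \<Omega> R (fst q) \<and> simple_fun \<Omega> R (snd q)"
    by (rule eventually_prodI[OF eventually_simple eventually_simple])
  ultimately show ?thesis
    by eventually_elim (simp add: simple_fun_integral_eq)
qed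

definition indefinite_integral :: "'w set \<Rightarrow> 'z" ("\<nu>") where
  "indefinite_integral A = (SOME z. ((\<lambda>s. level_integral s A) \<longlongrightarrow> z) F)"

lemma indefinite_integral_limit:
  assumes A: "A \<in> H"
  shows "((\<lambda>s. level_integral s A) \<longlongrightarrow> \<nu> A) F"
proof -
  let ?G = "filtermap (\<lambda>s. level_integral s A) F"
  have "tvs_cauchy_filter ?G"
    unfolding tvs_cauchy_filter_def
  proof (rule topological_tendstoI)
    fix U :: "'z set" assume "open U" "0 \<in> U"
    then have "0 \<in> interior U" by (simp add: interior_open)
    from approx_Cauchy[OF this] obtain P Q where PQ: "eventually P F" "eventually Q F"
      "\<And>s t. P s \<Longrightarrow> Q t \<Longrightarrow> level_integral s A - level_integral t A \<in> U"
      unfolding eventually_prod_filter using A by auto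
    show "\<forall>\<^sub>F q in ?G \<times>\<^sub>F ?G. fst q - snd q \<in> U"
      unfolding eventually_prod_filter eventually_filtermap
    proof (intro exI conjI allI impI)
      show "\<forall>\<^sub>F s in F. level_integral s A \<in> (\<lambda>s. level_integral s A) ` Collect P"
        using PQ(1) by (rule eventually_mono) blast
      show "\<forall>\<^sub>F s in F. level_integral s A \<in> (\<lambda>s. level_integral s A) ` Collect Q"
        using PQ(2) by (rule eventually_mono) blast
    qed (use PQ(3) in auto)
  qed
  moreover have "?G \<noteq> bot" using F_nonbot by (simp add: filtermap_bot_iff)
  ultimately obtain z where "?G \<le> nhds z"
    using complete_Z unfolding tvs_complete_def by blast
  then have "\<exists>z. ((\<lambda>s. level_integral s A) \<longlongrightarrow> z) F"
    unfolding filterlim_def by blast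
  then show ?thesis
    unfolding indefinite_integral_def by (rule someI_ex)
qed

text \<open>
  The Cauchy condition is uniform in \<open>A\<close>; letting the second function run along \<open>F\<close> keeps the
  difference in the closed set \<open>W\<close>.
\<close>

lemma indefinite_integral_uniform:
  assumes W: "closed W" "0 \<in> interior W"
  shows "\<forall>\<^sub>F s in F. \<forall>A\<in>H. level_integral s A - \<nu> A \<in> W"
proof -
  obtain P Q where PQ: "eventually P F" "eventually Q F"
    "\<And>s t. P s \<Longrightarrow> Q t \<Longrightarrow> \<forall>A\<in>H. level_integral s A - level_integral t A \<in> W"
    using approx_Cauchy[OF W(2)] unfolding eventually_prod_filter by auto
  from PQ(1) show ?thesis
  proof (rule eventually_mono, intro ballI)
    fix s A assume s: "P s" and A: "A \<in> H"
    have "((\<lambda>t. level_integral s A - level_integral t A) \<longlongrightarrow> level_integral s A - \<nu> A) F"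
      by (intro tendsto_diff tendsto_const indefinite_integral_limit A)
    moreover have "\<forall>\<^sub>F t in F. level_integral s A - level_integral t A \<in> W"
      using PQ(2) by (rule eventually_mono) (use PQ(3) s A in blast)
    ultimately show "level_integral s A - \<nu> A \<in> W"
      by (intro Lim_in_closed_set[OF W(1) _ F_nonbot])
  qed
qed

lemma indefinite_integral_UN_finite:
  assumes "finite I" "\<And>i. i \<in> I \<Longrightarrow> B i \<in> H" "disjoint_family_on B I"
  shows "\<nu> (\<Union>i\<in>I. B i) = (\<Sum>i\<in>I. \<nu> (B i))"
proof (rule tendsto_unique[OF F_nonbot])
  show "((\<lambda>s. level_integral s (\<Union>i\<in>I. B i)) \<longlongrightarrow> \<nu> (\<Union>i\<in>I. B i)) F"
    using assms by (intro indefinite_integral_limit finite_UN) auto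
  have "((\<lambda>s. \<Sum>i\<in>I. level_integral s (B i)) \<longlongrightarrow> (\<Sum>i\<in>I. \<nu> (B i))) F"
    using assms by (intro tendsto_sum indefinite_integral_limit) auto
  moreover have "\<forall>\<^sub>F s in F. (\<Sum>i\<in>I. level_integral s (B i)) = level_integral s (\<Union>i\<in>I. B i)"
    using eventually_simple
    by (rule eventually_mono)
      (rule vector_measure.measure_UN_finite[OF level_integral_sigma_additive assms, symmetric])
  ultimately show "((\<lambda>s. level_integral s (\<Union>i\<in>I. B i)) \<longlongrightarrow> (\<Sum>i\<in>I. \<nu> (B i))) F"
    by (rule Lim_transform_eventually)
qed

text \<open>
  A uniform limit of \<open>\<sigma>\<close>-additive set functions: \<open>\<nu>\<close> of a tail is compared with the integral of one
  simple function over it.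
\<close>

lemma indefinite_integral_sigma_additive: "vector_measure \<Omega> H \<nu>"
proof
  show "sigma_additive H \<nu>"
    unfolding sigma_additive_def
  proof (intro allI impI)
    fix A :: "nat \<Rightarrow> 'w set" assume A: "range A \<subseteq> H" "disjoint_family A"
    let ?T = "finite_subsets_at_top (UNIV :: nat set)"
    have UA: "(\<Union>i. A i) \<in> H" using A(1) by blast
    have "((\<lambda>J. (\<Sum>i\<in>J. \<nu> (A i)) - \<nu> (\<Union>i. A i)) \<longlongrightarrow> 0) ?T"
    proof (rule topological_tendstoI)
      fix U :: "'z set" assume "open U" "0 \<in> U"
      then have "0 \<in> interior U" by (simp add: interior_open)
      then obtain U' where U': "closed U'" "0 \<in> interior U'" "\<forall>a\<in>U'. - a \<in> U'"
        "\<forall>a\<in>U'. \<forall>b\<in>U'. a + b \<in> U"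
        using half_nbhd[of U] by metis
      obtain W where W: "closed W" "0 \<in> interior W" "\<forall>a\<in>W. - a \<in> W"
        "\<forall>a\<in>W. \<forall>b\<in>W. a + b \<in> U'"
        using half_nbhd[OF U'(2)] by metis
      have "\<forall>\<^sub>F s in F. simple_fun \<Omega> R s \<and> (\<forall>A\<in>H. level_integral s A - \<nu> A \<in> W)"
        using eventually_simple indefinite_integral_uniform[OF W(1,2)] by (rule eventually_conj)
      then obtain s where s: "simple_fun \<Omega> R s" "\<And>A. A \<in> H \<Longrightarrow> level_integral s A - \<nu> A \<in> W"
        using eventually_happens'[OF F_nonbot] by blast
      interpret s: vector_measure \<Omega> H "level_integral s"
        by (rule level_integral_sigma_additive[OF s(1)])
      have "((\<lambda>J. (\<Sum>i\<in>J. level_integral s (A i)) - level_integral s (\<Union>i. A i)) \<longlongrightarrow>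
          level_integral s (\<Union>i. A i) - level_integral s (\<Union>i. A i)) ?T"
        using s.has_sum_disjoint_family[OF A] unfolding has_sum_def
        by (intro tendsto_diff tendsto_const)
      then have "\<forall>\<^sub>F J in ?T. (\<Sum>i\<in>J. level_integral s (A i)) - level_integral s (\<Union>i. A i) \<in> interior W"
        by (rule topological_tendstoD) (use W(2) in simp_all)
      then show "\<forall>\<^sub>F J in ?T. (\<Sum>i\<in>J. \<nu> (A i)) - \<nu> (\<Union>i. A i) \<in> U"
      proof (rule eventually_rev_mp, intro eventually_finite_subsets_at_top_weakI impI)
        fix J :: "nat set"
        assume J: "finite J"
          "(\<Sum>i\<in>J. level_integral s (A i)) - level_integral s (\<Union>i. A i) \<in> interior W"
        have AH: "A i \<in> H" for i using A(1) by blast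
        have disj: "disjoint_family_on A J" using A(2) by (auto simp: disjoint_family_on_def)
        let ?B = "\<Union>i\<in>J. A i"
        have BH: "?B \<in> H" using J(1) AH by blast
        have 1: "level_integral s ?B - level_integral s (\<Union>i. A i) \<in> W"
          using J interior_subset[of W] s.measure_UN_finite[OF J(1) AH disj] by auto
        have 2: "- (level_integral s ?B - \<nu> ?B) \<in> W"
          using s(2)[OF BH] W(3) by blast
        have 3: "level_integral s (\<Union>i. A i) - \<nu> (\<Union>i. A i) \<in> U'"
        proof -
          have "level_integral s (\<Union>i. A i) - \<nu> (\<Union>i. A i) \<in> W" by (rule s(2)[OF UA])
          moreover have "0 \<in> W" using W(2) by (rule zero_interior_mem)
          ultimately have "level_integral s (\<Union>i. A i) - \<nu> (\<Union>i. A i) + 0 \<in> U'" using W(4) by blast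
          then show ?thesis by simp
        qed
        have "\<nu> ?B - \<nu> (\<Union>i. A i) = (- (level_integral s ?B - \<nu> ?B) +
          (level_integral s ?B - level_integral s (\<Union>i. A i))) +
          (level_integral s (\<Union>i. A i) - \<nu> (\<Union>i. A i))" by simp
        also have "\<dots> \<in> U" using 1 2 3 W(4) U'(4) by blast
        finally show "(\<Sum>i\<in>J. \<nu> (A i)) - \<nu> (\<Union>i. A i) \<in> U"
          using indefinite_integral_UN_finite[OF J(1) AH disj] by simp
      qed
    qed
    then have "((\<lambda>J. (\<Sum>i\<in>J. \<nu> (A i)) - \<nu> (\<Union>i. A i) + \<nu> (\<Union>i. A i)) \<longlongrightarrow> 0 + \<nu> (\<Union>i. A i)) ?T"
      by (intro tendsto_add tendsto_const)
    then show "((\<lambda>i. \<nu> (A i)) has_sum \<nu> (\<Union>i. A i)) UNIV"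
      by (simp add: has_sum_def)
  qed
qed

lemma indefinite_integral_null:
  assumes A: "A \<in> H" and null: "\<And>B x. B \<in> H \<Longrightarrow> B \<subseteq> A \<Longrightarrow> p x (\<mu> B) = 0"
  shows "\<nu> A = 0"
proof (rule tendsto_unique[OF F_nonbot indefinite_integral_limit[OF A]])
  have "\<forall>\<^sub>F s in F. 0 = level_integral s A"
    using eventually_simple
  proof (rule eventually_mono)
    fix s :: "'w \<Rightarrow> 'x" assume "simple_fun \<Omega> R s"
    then show "0 = level_integral s A"
      unfolding level_integral_def using A simple_fun_levels(2)
      by (intro sum.neutral[symmetric] ballI null Int) auto
  qed
  then show "((\<lambda>s. level_integral s A) \<longlongrightarrow> 0) F"
    by (rule Lim_transform_eventually[OF tendsto_const])
qed

text \<open>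
  What the Riemann sums need from Masse integrability: a simple function \<open>g\<close> with nearly the same
  integrals as \<open>f\<close>, such that outside a set \<open>E\<close> of small control submeasure finite semivariation makes
  the Riemann sums of \<open>g - f\<close> small, whatever the number of terms.
\<close>

lemma approximating_simple_function:
  assumes W: "closed W" "0 \<in> interior W" and "0 < e"
  shows "\<exists>g E. simple_fun \<Omega> R g \<and> E \<in> H \<and> \<eta> E \<le> ennreal e \<and>
    (\<forall>A\<in>H. level_integral g A - \<nu> A \<in> W) \<and>
    (\<forall>C \<delta>. finite C \<longrightarrow> C \<subseteq> H \<longrightarrow> disjoint C \<longrightarrow> (\<forall>\<alpha>\<in>C. \<delta> \<alpha> \<in> \<Omega> - E) \<longrightarrow>
      (\<Sum>\<alpha>\<in>C. p (g (\<delta> \<alpha>) - f (\<delta> \<alpha>)) (\<mu> \<alpha>)) \<in> W)"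
proof -
  obtain U where U: "0 \<in> interior U" "\<And>C u. finite C \<Longrightarrow> C \<subseteq> H \<Longrightarrow> disjoint C \<Longrightarrow>
      (\<forall>\<alpha>\<in>C. u \<alpha> \<in> U) \<Longrightarrow> (\<Sum>\<alpha>\<in>C. p (u \<alpha>) (\<mu> \<alpha>)) \<in> W"
    using semivariation W(2) unfolding finite_semivariation_def by metis
  \<comment> \<open>Strict bounds \<open>d < r d\<close> are wanted off the exceptional set, whereas convergence in submeasure
    gives non-strict ones; hence the halved radii below.\<close>
  obtain D0 r where D0: "finite D0" "D0 \<subseteq> D" "\<forall>d\<in>D0. 0 < r d" "{x. \<forall>d\<in>D0. d x < r d} \<subseteq> U"
    using seminorm_nbhd[OF seminorms U(1)] .
  let ?B = "\<lambda>d g. {\<omega>\<in>\<Omega>. d (g \<omega> - f \<omega>) > r d / 2}"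
  have "\<forall>\<^sub>F g in F. \<exists>A\<in>H. (\<Union>d\<in>D0. ?B d g) \<subseteq> A \<and> \<eta> A \<le> ennreal e"
  proof (rule control_cover_finite[OF sigma_algebra_axioms control submeasures D0(1)])
    fix \<xi> d assume "\<xi> \<in> S" "d \<in> D0"
    moreover from this have "d \<in> D" "0 < r d / 2" using D0(2,3) by auto
    ultimately show "((\<lambda>g. submeasure_ext H \<xi> (?B d g)) \<longlongrightarrow> 0) F"
      using approx unfolding masse_approx_def converges_in_submeasure_def by blast
  qed (use \<open>0 < e\<close> in auto)
  then have "\<forall>\<^sub>F g in F. (\<exists>A\<in>H. (\<Union>d\<in>D0. ?B d g) \<subseteq> A \<and> \<eta> A \<le> ennreal e) \<and>
      simple_fun \<Omega> R g \<and> (\<forall>A\<in>H. level_integral g A - \<nu> A \<in> W)"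
    using eventually_simple indefinite_integral_uniform[OF W] by (intro eventually_conj)
  then obtain g where g: "\<exists>A\<in>H. (\<Union>d\<in>D0. ?B d g) \<subseteq> A \<and> \<eta> A \<le> ennreal e"
    "simple_fun \<Omega> R g" "\<forall>A\<in>H. level_integral g A - \<nu> A \<in> W"
    using eventually_happens'[OF F_nonbot] by blast
  then obtain E where E: "E \<in> H" "(\<Union>d\<in>D0. ?B d g) \<subseteq> E" "\<eta> E \<le> ennreal e" by blast
  have inU: "g \<omega> - f \<omega> \<in> U" if "\<omega> \<in> \<Omega> - E" for \<omega>
  proof -
    have "d (g \<omega> - f \<omega>) < r d" if d: "d \<in> D0" for d
    proof -
      have "\<not> d (g \<omega> - f \<omega>) > r d / 2" using E(2) \<open>\<omega> \<in> \<Omega> - E\<close> d by blast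
      moreover have "0 < r d" using D0(3) d by blast
      ultimately show ?thesis by linarith
    qed
    then show ?thesis using D0(4) by blast
  qed
  show ?thesis
  proof (intro exI conjI allI impI)
    fix C \<delta> assume "finite C" "C \<subseteq> H" "disjoint C" "\<forall>\<alpha>\<in>C. \<delta> \<alpha> \<in> \<Omega> - E"
    then show "(\<Sum>\<alpha>\<in>C. p (g (\<delta> \<alpha>) - f (\<delta> \<alpha>)) (\<mu> \<alpha>)) \<in> W"
      using inU by (intro U(2)) auto
  qed (use g E in auto)
qed

end

section \<open>Partitions\<close>

text \<open>
  Refining the fibre partition of a function \<open>key\<close> just means that \<open>key\<close> is constant on the pieces.
  This turns the order on partitions into a condition on points.
\<close>

lemma fibre_partition:
  assumes H: "sigma_algebra \<Omega> H" and A: "A \<in> H"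
    and "countable (key ` \<Omega>)" "\<And>c. {\<omega>\<in>\<Omega>. key \<omega> = c} \<in> H"
  shows "\<exists>P\<in>countable_partitions H A. \<forall>Q. partition_le P Q \<longrightarrow>
    (\<forall>\<beta>\<in>Q. \<forall>\<omega>\<in>\<beta>. \<forall>\<omega>'\<in>\<beta>. key \<omega> = key \<omega>')"
proof -
  interpret sigma_algebra \<Omega> H by (rule H)
  have sub: "A \<subseteq> \<Omega>" using A sets_into_space by blast
  define P where "P = (\<lambda>c. {\<omega>\<in>A. key \<omega> = c}) ` key ` A"
  have "{\<omega>\<in>A. key \<omega> = c} = A \<inter> {\<omega>\<in>\<Omega>. key \<omega> = c}" for c
    using sub by blast
  then have "{\<omega>\<in>A. key \<omega> = c} \<in> H" for c
    using A assms(4) by (metis Int)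
  moreover have "countable (key ` A)"
    using assms(3) sub by (meson countable_subset image_mono)
  ultimately have "P \<in> countable_partitions H A"
    unfolding countable_partitions_def P_def by (auto simp: disjoint_def)
  moreover have "key \<omega> = key \<omega>'"
    if "partition_le P Q" "\<beta> \<in> Q" "\<omega> \<in> \<beta>" "\<omega>' \<in> \<beta>" for Q \<beta> \<omega> \<omega>'
  proof -
    obtain \<alpha> where "\<alpha> \<in> P" "\<beta> \<subseteq> \<alpha>" using \<open>partition_le P Q\<close> \<open>\<beta> \<in> Q\<close> by (auto simp: partition_le_def)
    moreover obtain c where "\<alpha> = {\<omega>\<in>A. key \<omega> = c}" using \<open>\<alpha> \<in> P\<close> by (auto simp: P_def)
    ultimately have "key \<omega> = c" "key \<omega>' = c" using that(3,4) by blast+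
    then show ?thesis by simp
  qed
  ultimately show ?thesis by blast
qed

lemma common_refinement:
  assumes H: "sigma_algebra \<Omega> H" and PQ: "P \<in> countable_partitions H A" "Q \<in> countable_partitions H A"
  shows "\<exists>T\<in>countable_partitions H A. partition_le P T \<and> partition_le Q T"
proof -
  interpret sigma_algebra \<Omega> H by (rule H)
  define T where "T = (\<lambda>(\<alpha>, \<beta>). \<alpha> \<inter> \<beta>) ` (P \<times> Q) - {{}}"
  have P: "countable P" "P \<subseteq> H" "disjoint P" "\<Union>P = A"
    and Q: "countable Q" "Q \<subseteq> H" "disjoint Q" "\<Union>Q = A"
    using PQ by (auto simp: countable_partitions_def)
  have "countable T" using P(1) Q(1) by (auto simp: T_def)
  moreover have "T \<subseteq> H" using P(2) Q(2) by (auto simp: T_def)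
  moreover have "disjoint T"
  proof (rule disjointI)
    fix a b assume "a \<in> T" "b \<in> T" "a \<noteq> b"
    then obtain \<alpha> \<beta> \<alpha>' \<beta>' where ab: "a = \<alpha> \<inter> \<beta>" "b = \<alpha>' \<inter> \<beta>'" "\<alpha> \<in> P" "\<alpha>' \<in> P" "\<beta> \<in> Q" "\<beta>' \<in> Q"
      by (auto simp: T_def)
    then have "\<alpha> \<noteq> \<alpha>' \<or> \<beta> \<noteq> \<beta>'" using \<open>a \<noteq> b\<close> by blast
    then show "a \<inter> b = {}"
      using disjointD[OF P(3) ab(3,4)] disjointD[OF Q(3) ab(5,6)] ab(1,2) by blast
  qed
  moreover have "\<Union>T = A"
  proof
    show "\<Union>T \<subseteq> A" using P(4) by (auto simp: T_def)
    show "A \<subseteq> \<Union>T"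
    proof
      fix \<omega> assume "\<omega> \<in> A"
      then obtain \<alpha> \<beta> where "\<alpha> \<in> P" "\<omega> \<in> \<alpha>" "\<beta> \<in> Q" "\<omega> \<in> \<beta>" using P(4) Q(4) by blast
      then show "\<omega> \<in> \<Union>T" unfolding T_def by (intro UnionI[of "\<alpha> \<inter> \<beta>"]) auto
    qed
  qed
  ultimately have "T \<in> countable_partitions H A"
    by (auto simp: countable_partitions_def T_def)
  moreover have "partition_le P T" "partition_le Q T"
    unfolding partition_le_def T_def by auto
  ultimately show ?thesis by blast
qed

text \<open>
  Two integrals are compared through the Riemann series of one common refinement. This uniqueness
  also yields that different approximating filters define the same Masse integral.
\<close>

lemma sstar_integral_unique:
  assumes H: "sigma_algebra \<Omega> H"
    and 1: "has_sstar_integral p \<Omega> H \<mu> A f z\<^sub>1" and 2: "has_sstar_integral p \<Omega> H \<mu> A f z\<^sub>2"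
  shows "z\<^sub>1 = z\<^sub>2"
proof (rule ccontr)
  assume "z\<^sub>1 \<noteq> z\<^sub>2"
  then have "0 \<noteq> z\<^sub>2 - z\<^sub>1" by simp
  then obtain U where U: "open U" "0 \<in> U" "z\<^sub>2 - z\<^sub>1 \<notin> U" by (metis t1_space)
  then have "0 \<in> interior U" by (simp add: interior_open)
  then obtain V where V: "0 \<in> interior V" "\<forall>a\<in>V. - a \<in> V" "\<forall>a\<in>V. \<forall>b\<in>V. a + b \<in> U"
    using half_nbhd[of U] by metis
  obtain P where P: "P \<in> countable_partitions H A"
    "\<And>T \<delta>. T \<in> countable_partitions H A \<Longrightarrow> partition_le P T \<Longrightarrow> choice_function \<Omega> \<delta> \<Longrightarrow>
      (\<Sum>\<^sub>\<infinity>\<alpha>\<in>T. p (f (\<delta> \<alpha>)) (\<mu> \<alpha>)) - z\<^sub>1 \<in> V"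
    using 1 V(1) unfolding has_sstar_integral_def by metis
  obtain Q where Q: "Q \<in> countable_partitions H A"
    "\<And>T \<delta>. T \<in> countable_partitions H A \<Longrightarrow> partition_le Q T \<Longrightarrow> choice_function \<Omega> \<delta> \<Longrightarrow>
      (\<Sum>\<^sub>\<infinity>\<alpha>\<in>T. p (f (\<delta> \<alpha>)) (\<mu> \<alpha>)) - z\<^sub>2 \<in> V"
    using 2 V(1) unfolding has_sstar_integral_def by metis
  obtain T where T: "T \<in> countable_partitions H A" "partition_le P T" "partition_le Q T"
    using common_refinement[OF H P(1) Q(1)] by blast
  define \<delta> where "\<delta> \<alpha> = (SOME \<omega>. \<omega> \<in> \<alpha>)" for \<alpha> :: "'a set"
  have \<delta>: "choice_function \<Omega> \<delta>"
    by (auto simp: choice_function_def \<delta>_def some_in_eq)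
  let ?s = "\<Sum>\<^sub>\<infinity>\<alpha>\<in>T. p (f (\<delta> \<alpha>)) (\<mu> \<alpha>)"
  have "(?s - z\<^sub>1) + - (?s - z\<^sub>2) \<in> U"
    using P(2)[OF T(1,2) \<delta>] Q(2)[OF T(1,3) \<delta>] V(2,3) by blast
  then show False using U(3) by simp
qed

section \<open>Convergence of the Riemann sums\<close>

text \<open>
  The sequence replacing Egoroff's theorem. On the complement of \<open>\<Union>n\<ge>k. E n\<close> the functions \<open>g n\<close>,
  \<open>n \<ge> k\<close>, are uniformly close to \<open>f\<close> in the sense that their Riemann sums are.
\<close>

locale egoroff_sequence = masse_integrand \<Omega> H \<mu> p R S \<eta> D F f + W: zero_chain W
  for \<Omega> :: "'w set" and H :: "'w set set" and \<mu> :: "'w set \<Rightarrow> 'y::{real_tvs,t2_space}"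
    and p :: "'x::{real_tvs,t2_space} \<Rightarrow> 'y \<Rightarrow> 'z::{real_tvs,t2_space}" and R :: "'w set set"
    and S :: "('w set \<Rightarrow> ennreal) set" and \<eta> :: "'w set \<Rightarrow> ennreal"
    and D :: "('x \<Rightarrow> real) set" and F :: "('w \<Rightarrow> 'x) filter" and f :: "'w \<Rightarrow> 'x"
    and W :: "nat \<Rightarrow> 'z set" +
  fixes g :: "nat \<Rightarrow> 'w \<Rightarrow> 'x" and E :: "nat \<Rightarrow> 'w set"
  assumes simple_g: "simple_fun \<Omega> R (g k)"
    and E_sets: "E k \<in> H"
    and E_small: "\<eta> (E k) \<le> ennreal (1 / 2 ^ k)"
    and g_integral: "A \<in> H \<Longrightarrow> level_integral (g k) A - indefinite_integral A \<in> W k"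
    and g_close: "finite C \<Longrightarrow> C \<subseteq> H \<Longrightarrow> disjoint C \<Longrightarrow> (\<And>\<alpha>. \<alpha> \<in> C \<Longrightarrow> \<delta> \<alpha> \<in> \<Omega> - E k) \<Longrightarrow>
      (\<Sum>\<alpha>\<in>C. p (g k (\<delta> \<alpha>) - f (\<delta> \<alpha>)) (\<mu> \<alpha>)) \<in> W k"
begin

interpretation ii: vector_measure \<Omega> H \<nu>
  by (rule indefinite_integral_sigma_additive)

definition uniform_part :: "nat \<Rightarrow> 'w set" where
  "uniform_part k = \<Omega> - (\<Union>n\<in>{k..}. E n)"

definition exceptional :: "'w set" where
  "exceptional = \<Omega> - (\<Union>k. uniform_part k)"

definition rank :: "'w \<Rightarrow> nat" where
  "rank \<omega> = (LEAST k. \<omega> \<in> uniform_part k)"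

text \<open>
  The fibres of \<open>key j\<close> are the null set \<open>exceptional\<close> and, within the set of points of rank \<open>k\<close>, the
  level sets of \<open>g (j + k)\<close>. The precision of the simple function grows with the rank, so that the
  errors of the infinitely many ranks have a small sum. Riemann sums accurate up to \<open>W j\<close> come from
  \<open>key (j + 2)\<close>.
\<close>

definition key :: "nat \<Rightarrow> 'w \<Rightarrow> (nat \<times> 'x) option" where
  "key j \<omega> = (if \<omega> \<in> exceptional then None else Some (rank \<omega>, g (j + rank \<omega>) \<omega>))"

lemma uniform_part_sets: "uniform_part k \<in> H" and exceptional_sets: "exceptional \<in> H"
proof -
  have "(\<Union>n\<in>{k..}. E n) \<in> H" for k using E_sets by (intro countable_UN') auto
  then show uniform_part: "uniform_part k \<in> H" for k by (auto simp: uniform_part_def)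
  then have "(\<Union>k. uniform_part k) \<in> H" by blast
  then show "exceptional \<in> H" by (auto simp: exceptional_def)
qed

lemma uniform_part_rank: "\<omega> \<in> \<Omega> \<Longrightarrow> \<omega> \<notin> exceptional \<Longrightarrow> \<omega> \<in> uniform_part (rank \<omega>)"
  unfolding rank_def exceptional_def by (rule LeastI_ex) auto

lemma not_E_rank: "\<omega> \<in> \<Omega> \<Longrightarrow> \<omega> \<notin> exceptional \<Longrightarrow> rank \<omega> \<le> n \<Longrightarrow> \<omega> \<in> \<Omega> - E n"
  using uniform_part_rank[of \<omega>] by (auto simp: uniform_part_def)

lemma exceptional_null:
  assumes "A \<in> H" "A \<subseteq> exceptional"
  shows "p x (\<mu> A) = 0"
proof (rule limsup_null[OF E_sets E_small assms(1)])
  show "A \<subseteq> (\<Inter>k. \<Union>n\<in>{k..}. E n)"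
    using assms(2) by (auto simp: exceptional_def uniform_part_def)
qed

lemma exceptional_integral: "A \<in> H \<Longrightarrow> A \<subseteq> exceptional \<Longrightarrow> \<nu> A = 0"
  by (intro indefinite_integral_null exceptional_null) auto

lemma key_countable: "countable (key j ` \<Omega>)"
proof (rule countable_subset)
  show "key j ` \<Omega> \<subseteq> insert None (\<Union>k. (\<lambda>v. Some (k, v)) ` g (j + k) ` \<Omega>)"
    by (auto simp: key_def)
  show "countable (insert None (\<Union>k. (\<lambda>v. Some (k, v)) ` g (j + k) ` \<Omega>))"
    using simple_fun_levels(1)[OF simple_g]
    by (intro countable_insert countable_UN countable_image) (auto intro: countable_finite)
qed

lemma key_sets: "{\<omega>\<in>\<Omega>. key j \<omega> = c} \<in> H"
proof (cases c)
  case None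
  have "{\<omega>\<in>\<Omega>. key j \<omega> = c} = exceptional"
    using None by (auto simp: key_def exceptional_def)
  then show ?thesis using exceptional_sets by simp
next
  case (Some kv)
  obtain k v where kv: "kv = (k, v)" by (cases kv)
  have rank: "\<omega> \<notin> exceptional \<and> rank \<omega> = k \<longleftrightarrow> \<omega> \<in> disjointed uniform_part k" if "\<omega> \<in> \<Omega>" for \<omega>
  proof
    assume \<omega>: "\<omega> \<notin> exceptional \<and> rank \<omega> = k"
    then have "\<omega> \<in> uniform_part k" using uniform_part_rank[OF that] by blast
    moreover have "\<omega> \<notin> uniform_part i" if "i < k" for i
      using \<omega> that not_less_Least[of i "\<lambda>k. \<omega> \<in> uniform_part k"] unfolding rank_def by blast
    ultimately show "\<omega> \<in> disjointed uniform_part k" by (simp add: disjointed_def)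
  next
    assume \<omega>: "\<omega> \<in> disjointed uniform_part k"
    have "rank \<omega> = k"
      unfolding rank_def
    proof (rule Least_equality)
      show "\<omega> \<in> uniform_part k" using \<omega> by (simp add: disjointed_def)
      show "k \<le> i" if "\<omega> \<in> uniform_part i" for i
        using \<omega> that by (force simp: disjointed_def not_less[symmetric])
    qed
    moreover have "\<omega> \<notin> exceptional" using \<omega> by (auto simp: exceptional_def disjointed_def)
    ultimately show "\<omega> \<notin> exceptional \<and> rank \<omega> = k" by blast
  qed
  have "{\<omega>\<in>\<Omega>. key j \<omega> = c} = {\<omega>\<in>\<Omega>. g (j + k) \<omega> = v} \<inter> disjointed uniform_part k"
    using rank by (auto simp: Some kv key_def split: if_splits)
  moreover have "disjointed uniform_part k \<in> H"
    using range_disjointed_sets[of uniform_part] uniform_part_sets by blast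
  ultimately show ?thesis using simple_fun_levels(2)[OF simple_g] by auto
qed

text \<open>
  Families of pieces with sample points as they arise from partitions finer than the fibre
  partition of \<open>key j\<close>.
\<close>

definition key_family :: "nat \<Rightarrow> 'w set set \<Rightarrow> ('w set \<Rightarrow> 'w) \<Rightarrow> bool" where
  "key_family j C \<delta> \<longleftrightarrow> C \<subseteq> H \<and> disjoint C \<and>
    (\<forall>\<alpha>\<in>C. \<delta> \<alpha> \<in> \<alpha> \<and> (\<forall>\<omega>\<in>\<alpha>. key j \<omega> = key j (\<delta> \<alpha>)))"

lemma key_family_subset: "key_family j C \<delta> \<Longrightarrow> C' \<subseteq> C \<Longrightarrow> key_family j C' \<delta>"
  unfolding key_family_def by (meson pairwise_subset subset_eq)

lemma key_family_key: "key_family j C \<delta> \<Longrightarrow> \<alpha> \<in> C \<Longrightarrow> \<omega> \<in> \<alpha> \<Longrightarrow> key j \<omega> = key j (\<delta> \<alpha>)"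
  unfolding key_family_def by blast

lemma key_family_sample: "key_family j C \<delta> \<Longrightarrow> \<alpha> \<in> C \<Longrightarrow> \<delta> \<alpha> \<in> \<Omega>"
  unfolding key_family_def using sets_into_space by blast

text \<open>
  On pieces of rank \<open>k\<close> the function \<open>g n\<close>, \<open>n = j + k + 2\<close>, is constant, so its Riemann sum is its
  integral over the union. The error is therefore a Riemann sum of \<open>g n - f\<close> and a difference of
  indefinite integrals on the single set \<open>\<Union>C\<close>, each in \<open>W n\<close>; neither bound depends on the number of
  pieces.
\<close>

lemma Riemann_sum_rank:
  assumes C: "finite C" "key_family (Suc (Suc j)) C \<delta>"
    and rank: "\<And>\<alpha>. \<alpha> \<in> C \<Longrightarrow> \<delta> \<alpha> \<notin> exceptional \<and> rank (\<delta> \<alpha>) = k"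
  shows "(\<Sum>\<alpha>\<in>C. p (f (\<delta> \<alpha>)) (\<mu> \<alpha>) - \<nu> \<alpha>) \<in> W (Suc (j + k))"
proof -
  let ?n = "Suc (Suc (j + k))"
  interpret gi: vector_measure \<Omega> H "level_integral (g ?n)"
    by (rule level_integral_sigma_additive[OF simple_g])
  have CH: "C \<subseteq> H" "disjoint C" using C(2) by (auto simp: key_family_def)
  have "level_integral (g ?n) \<alpha> = p (g ?n (\<delta> \<alpha>)) (\<mu> \<alpha>)" if \<alpha>: "\<alpha> \<in> C" for \<alpha>
  proof (rule level_integral_const[OF simple_g])
    show "\<alpha> \<subseteq> \<Omega>" using CH \<alpha> sets_into_space by blast
    show "\<delta> \<alpha> \<in> \<alpha>" using C(2) \<alpha> unfolding key_family_def by blast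
    fix \<omega> assume "\<omega> \<in> \<alpha>"
    with C(2) \<alpha> have "key (Suc (Suc j)) \<omega> = key (Suc (Suc j)) (\<delta> \<alpha>)"
      by (rule key_family_key)
    then show "g ?n \<omega> = g ?n (\<delta> \<alpha>)"
      using rank[OF \<alpha>] by (auto simp: key_def split: if_splits)
  qed
  then have "(\<Sum>\<alpha>\<in>C. p (f (\<delta> \<alpha>)) (\<mu> \<alpha>) - \<nu> \<alpha>) =
      (\<Sum>\<alpha>\<in>C. (level_integral (g ?n) \<alpha> - \<nu> \<alpha>) - p (g ?n (\<delta> \<alpha>) - f (\<delta> \<alpha>)) (\<mu> \<alpha>))"
    by (intro sum.cong) (auto simp: p_diff_left)
  also have "\<dots> = (level_integral (g ?n) (\<Union>C) - \<nu> (\<Union>C)) -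
      (\<Sum>\<alpha>\<in>C. p (g ?n (\<delta> \<alpha>) - f (\<delta> \<alpha>)) (\<mu> \<alpha>))"
    using C(1) CH by (simp add: sum_subtractf gi.measure_Union_finite ii.measure_Union_finite)
  also have "\<dots> \<in> W (Suc (j + k))"
  proof (rule W.diff_W)
    show "level_integral (g ?n) (\<Union>C) - \<nu> (\<Union>C) \<in> W ?n"
      using C(1) CH by (intro g_integral finite_Union) auto
    show "(\<Sum>\<alpha>\<in>C. p (g ?n (\<delta> \<alpha>) - f (\<delta> \<alpha>)) (\<mu> \<alpha>)) \<in> W ?n"
    proof (rule g_close[OF C(1) CH])
      fix \<alpha> assume "\<alpha> \<in> C"
      then show "\<delta> \<alpha> \<in> \<Omega> - E ?n"
        using rank key_family_sample[OF C(2)] by (intro not_E_rank) auto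
    qed
  qed
  finally show ?thesis .
qed

text \<open>
  The errors of the different ranks are summed along the chain. With \<open>K = 0\<close> this is the
  approximation of \<open>\<nu>\<close> by Riemann sums, with large \<open>K\<close> it controls the pieces of high rank.
\<close>

lemma Riemann_sum_close:
  assumes C: "finite C" "key_family (Suc (Suc j)) C \<delta>"
    and rank: "\<And>\<alpha>. \<alpha> \<in> C \<Longrightarrow> \<delta> \<alpha> \<in> exceptional \<or> K \<le> rank (\<delta> \<alpha>)"
  shows "(\<Sum>\<alpha>\<in>C. p (f (\<delta> \<alpha>)) (\<mu> \<alpha>)) - \<nu> (\<Union>C) \<in> W (j + K)"
proof -
  let ?h = "\<lambda>\<alpha>. p (f (\<delta> \<alpha>)) (\<mu> \<alpha>) - \<nu> \<alpha>"
  define C' where "C' = {\<alpha>\<in>C. \<delta> \<alpha> \<notin> exceptional}"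
  define I where "I = (\<lambda>\<alpha>. rank (\<delta> \<alpha>)) ` C'"
  have CH: "C \<subseteq> H" "disjoint C" using C(2) by (auto simp: key_family_def)
  have fin: "finite C'" "finite I" using C(1) by (auto simp: C'_def I_def)
  \<comment> \<open>Exceptional pieces contribute nothing, neither to the Riemann sum nor to \<open>\<nu>\<close>.\<close>
  have "?h \<alpha> = 0" if \<alpha>: "\<alpha> \<in> C - C'" for \<alpha>
  proof -
    have "\<omega> \<in> exceptional" if "\<omega> \<in> \<alpha>" for \<omega>
    proof -
      have "key (Suc (Suc j)) \<omega> = key (Suc (Suc j)) (\<delta> \<alpha>)"
        using C(2) \<alpha> that by (intro key_family_key) auto
      then show ?thesis using \<alpha> by (auto simp: C'_def key_def split: if_splits)
    qed
    then have "\<alpha> \<subseteq> exceptional" by blast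
    moreover have "\<alpha> \<in> H" using CH \<alpha> by blast
    ultimately show ?thesis by (simp add: exceptional_null exceptional_integral)
  qed
  then have "sum ?h C = sum ?h C'"
    using C(1) by (intro sum.mono_neutral_right) (auto simp: C'_def)
  also have "\<dots> = (\<Sum>k\<in>I. \<Sum>\<alpha>\<in>{\<alpha>\<in>C'. rank (\<delta> \<alpha>) = k}. ?h \<alpha>)"
    using fin by (intro sum.group[symmetric]) (auto simp: I_def)
  \<comment> \<open>The shift by \<open>j\<close> aligns the ranks with the indices of the chain.\<close>
  also have "\<dots> = (\<Sum>i\<in>(\<lambda>k. j + k) ` I. \<Sum>\<alpha>\<in>{\<alpha>\<in>C'. rank (\<delta> \<alpha>) = i - j}. ?h \<alpha>)"
    by (subst sum.reindex) (auto simp: inj_on_def)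
  also have "\<dots> \<in> W (j + K)"
  proof (rule W.sum_W)
    fix i assume "i \<in> (\<lambda>k. j + k) ` I"
    then obtain k where k: "i = j + k" "k \<in> I" by blast
    then have "K \<le> k" using rank by (auto simp: I_def C'_def)
    moreover have "(\<Sum>\<alpha>\<in>{\<alpha>\<in>C'. rank (\<delta> \<alpha>) = k}. ?h \<alpha>) \<in> W (Suc (j + k))"
      using C by (intro Riemann_sum_rank key_family_subset[OF C(2)]) (auto simp: C'_def)
    ultimately show "j + K \<le> i \<and> (\<Sum>\<alpha>\<in>{\<alpha>\<in>C'. rank (\<delta> \<alpha>) = i - j}. ?h \<alpha>) \<in> W (Suc i)"
      by (simp add: k)
  qed (use fin in simp)
  finally show ?thesis
    using C(1) CH by (simp add: sum_subtractf ii.measure_Union_finite)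
qed

text \<open>
  Cauchy criterion. Pieces of rank above \<open>K\<close> and exceptional pieces have a Riemann sum close to
  \<open>\<nu>\<close> of their union, which is small far out because \<open>\<nu>\<close> is \<open>\<sigma>\<close>-additive. For pieces of rank at most \<open>K\<close> finite
  semivariation alone only gives boundedness, so \<open>f\<close> is replaced by \<open>g K\<close>: it takes finitely many
  values \<open>v\<close>, and each \<open>v\<mu>\<close> is \<open>\<sigma>\<close>-additive. Here the pieces need not lie in level sets of \<open>g K\<close>;
  only the values at the sample points matter.
\<close>

lemma Riemann_series_summable:
  assumes P: "countable P" "key_family (Suc (Suc j)) P \<delta>"
  shows "(\<lambda>\<alpha>. p (f (\<delta> \<alpha>)) (\<mu> \<alpha>)) summable_on P"
proof (rule summable_on_if_Cauchy[OF complete_Z])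
  let ?h = "\<lambda>\<alpha>. p (f (\<delta> \<alpha>)) (\<mu> \<alpha>)"
  fix U :: "'z set" assume "0 \<in> interior U"
  then obtain n where n: "W n \<subseteq> U" using W.base_W by blast
  \<comment> \<open>Four errors in \<open>W K\<close> are added below, hence two halvings.\<close>
  define K where "K = Suc (Suc n)"
  have PH: "P \<subseteq> H" "disjoint P" using P(2) by (auto simp: key_family_def)
  have fin: "finite (g K ` \<Omega>)" by (rule simple_fun_levels(1)[OF simple_g])
  obtain J1 where J1: "finite J1" "J1 \<subseteq> P" "\<And>C. finite C \<Longrightarrow> C \<subseteq> P - J1 \<Longrightarrow> sum \<nu> C \<in> W K"
    using has_sum_Cauchy[OF ii.has_sum_countable[OF P(1) PH] W.zero_W[of K]] by metis
  obtain V where V: "0 \<in> interior V"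
    "\<And>w. (\<And>v. v \<in> g K ` \<Omega> \<Longrightarrow> w v \<in> V) \<Longrightarrow> sum w (g K ` \<Omega>) \<in> W K"
    using finite_sum_nbhd[OF fin W.zero_W[of K]] by metis
  have "\<exists>J. finite J \<and> J \<subseteq> P \<and> (\<forall>C. finite C \<longrightarrow> C \<subseteq> P - J \<longrightarrow> (\<Sum>\<alpha>\<in>C. p v (\<mu> \<alpha>)) \<in> V)" for v
    using has_sum_Cauchy[OF p_has_sum_right[OF has_sum_countable[OF P(1) PH]] V(1)] by metis
  then obtain J where J: "\<And>v. finite (J v)" "\<And>v. J v \<subseteq> P"
    "\<And>v C. finite C \<Longrightarrow> C \<subseteq> P - J v \<Longrightarrow> (\<Sum>\<alpha>\<in>C. p v (\<mu> \<alpha>)) \<in> V"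
    by metis
  define J2 where "J2 = J1 \<union> (\<Union>v\<in>g K ` \<Omega>. J v)"
  show "\<exists>J. finite J \<and> J \<subseteq> P \<and> (\<forall>C. finite C \<longrightarrow> C \<subseteq> P - J \<longrightarrow> sum ?h C \<in> U)"
  proof (intro exI[of _ J2] conjI allI impI)
    show "finite J2" unfolding J2_def using J1(1) J(1) fin by blast
    show "J2 \<subseteq> P" unfolding J2_def using J1(2) J(2) by blast
    fix C assume C: "finite C" "C \<subseteq> P - J2"
    define C1 where "C1 = {\<alpha>\<in>C. \<delta> \<alpha> \<notin> exceptional \<and> rank (\<delta> \<alpha>) \<le> K}"
    define C2 where "C2 = C - C1"
    have sub: "C1 \<subseteq> C" "C2 \<subseteq> C" by (auto simp: C1_def C2_def)
    have fin12: "finite C1" "finite C2" using C(1) sub finite_subset by auto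
    have key12: "key_family (Suc (Suc j)) C1 \<delta>" "key_family (Suc (Suc j)) C2 \<delta>"
      using sub C(2) by (auto intro!: key_family_subset[OF P(2)])
    have CH: "C1 \<subseteq> H" "disjoint C1" "C2 \<subseteq> H" "disjoint C2"
      using key12 by (auto simp: key_family_def)
    have tail: "sum ?h C2 - \<nu> (\<Union>C2) \<in> W K"
    proof -
      have "sum ?h C2 - \<nu> (\<Union>C2) \<in> W (j + K)"
        using key12(2) fin12(2) by (intro Riemann_sum_close) (auto simp: C1_def C2_def)
      then show ?thesis using W.W_antimono[of K "j + K"] by auto
    qed
    have "C2 \<subseteq> P - J1" using sub C(2) by (auto simp: J2_def)
    then have tail': "\<nu> (\<Union>C2) \<in> W K"
      using J1(3)[of C2] ii.measure_Union_finite[of C2] fin12 CH by simp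
    have head: "(\<Sum>\<alpha>\<in>C1. p (g K (\<delta> \<alpha>) - f (\<delta> \<alpha>)) (\<mu> \<alpha>)) \<in> W K"
    proof (rule g_close[OF fin12(1) CH(1,2)])
      fix \<alpha> assume "\<alpha> \<in> C1"
      then show "\<delta> \<alpha> \<in> \<Omega> - E K"
        using key_family_sample[OF key12(1)] by (intro not_E_rank) (auto simp: C1_def)
    qed
    have head': "(\<Sum>\<alpha>\<in>C1. p (g K (\<delta> \<alpha>)) (\<mu> \<alpha>)) \<in> W K"
    proof -
      have "(\<Sum>\<alpha>\<in>C1. p (g K (\<delta> \<alpha>)) (\<mu> \<alpha>)) =
          (\<Sum>v\<in>g K ` \<Omega>. \<Sum>\<alpha>\<in>{\<alpha>\<in>C1. g K (\<delta> \<alpha>) = v}. p (g K (\<delta> \<alpha>)) (\<mu> \<alpha>))"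
        using fin12 fin key_family_sample[OF key12(1)] by (intro sum.group[symmetric]) auto
      also have "\<dots> = (\<Sum>v\<in>g K ` \<Omega>. \<Sum>\<alpha>\<in>{\<alpha>\<in>C1. g K (\<delta> \<alpha>) = v}. p v (\<mu> \<alpha>))"
        by (intro sum.cong) auto
      also have "\<dots> \<in> W K"
      proof (rule V(2), rule J(3))
        fix v assume "v \<in> g K ` \<Omega>"
        then show "{\<alpha>\<in>C1. g K (\<delta> \<alpha>) = v} \<subseteq> P - J v"
          using sub C(2) by (auto simp: J2_def)
      qed (use fin12 in simp)
      finally show ?thesis .
    qed
    have "sum ?h C = ((\<Sum>\<alpha>\<in>C1. p (g K (\<delta> \<alpha>)) (\<mu> \<alpha>)) - (\<Sum>\<alpha>\<in>C1. p (g K (\<delta> \<alpha>) - f (\<delta> \<alpha>)) (\<mu> \<alpha>))) +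
        ((sum ?h C2 - \<nu> (\<Union>C2)) + \<nu> (\<Union>C2))"
      using sum.subset_diff[OF sub(1) C(1), of ?h]
      by (simp add: C2_def p_diff_left sum_subtractf)
    also have "\<dots> \<in> W n"
      unfolding K_def
      by (rule W.add_W[OF W.diff_W[OF head'[unfolded K_def] head[unfolded K_def]]
          W.add_W[OF tail[unfolded K_def] tail'[unfolded K_def]]])
    finally show "sum ?h C \<in> U" using n by blast
  qed
qed

lemma Riemann_series_close:
  assumes P: "countable P" "key_family (Suc (Suc j)) P \<delta>"
  shows "(\<Sum>\<^sub>\<infinity>\<alpha>\<in>P. p (f (\<delta> \<alpha>)) (\<mu> \<alpha>)) - \<nu> (\<Union>P) \<in> W j"
proof -
  let ?h = "\<lambda>\<alpha>. p (f (\<delta> \<alpha>)) (\<mu> \<alpha>)"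
  have PH: "P \<subseteq> H" "disjoint P" using P(2) by (auto simp: key_family_def)
  have "((\<lambda>C. sum ?h C - sum \<nu> C) \<longlongrightarrow> infsum ?h P - \<nu> (\<Union>P)) (finite_subsets_at_top P)"
    using has_sum_infsum[OF Riemann_series_summable[OF P]] ii.has_sum_countable[OF P(1) PH]
    unfolding has_sum_def by (rule tendsto_diff)
  moreover have "\<forall>\<^sub>F C in finite_subsets_at_top P. sum ?h C - sum \<nu> C \<in> W j"
  proof (rule eventually_finite_subsets_at_top_weakI)
    fix C assume C: "finite C" "C \<subseteq> P"
    then have key: "key_family (Suc (Suc j)) C \<delta>" using key_family_subset[OF P(2)] by blast
    then have "sum ?h C - \<nu> (\<Union>C) \<in> W (j + 0)"
      using C(1) by (intro Riemann_sum_close) auto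
    then show "sum ?h C - sum \<nu> C \<in> W j"
      using C(1) key by (simp add: key_family_def ii.measure_Union_finite)
  qed
  ultimately show ?thesis
    by (intro Lim_in_closed_set[OF W.closed_W _ finite_subsets_at_top_neq_bot])
qed

lemma has_sstar_integral_indefinite:
  assumes A: "A \<in> H"
  shows "has_sstar_integral p \<Omega> H \<mu> A f (\<nu> A)"
proof -
  have ex: "\<exists>P\<in>countable_partitions H A. \<forall>Q\<in>countable_partitions H A. partition_le P Q \<longrightarrow>
      (\<forall>\<delta>. choice_function \<Omega> \<delta> \<longrightarrow> countable Q \<and> key_family (Suc (Suc j)) Q \<delta> \<and> \<Union>Q = A)" for j
  proof -
    obtain P where P: "P \<in> countable_partitions H A"
      "\<And>Q \<beta> \<omega> \<omega>'. partition_le P Q \<Longrightarrow> \<beta> \<in> Q \<Longrightarrow> \<omega> \<in> \<beta> \<Longrightarrow> \<omega>' \<in> \<beta> \<Longrightarrow>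
        key (Suc (Suc j)) \<omega> = key (Suc (Suc j)) \<omega>'"
      using fibre_partition[OF sigma_algebra_axioms A key_countable key_sets, of "Suc (Suc j)"] by metis
    show ?thesis
    proof (intro bexI[OF _ P(1)] ballI impI allI)
      fix Q \<delta> assume Q: "Q \<in> countable_partitions H A" "partition_le P Q" "choice_function \<Omega> \<delta>"
      have "\<delta> \<alpha> \<in> \<alpha>" if "\<alpha> \<in> Q" for \<alpha>
      proof -
        have "\<alpha> \<noteq> {}" "\<alpha> \<subseteq> \<Omega>"
          using Q(1) that sets_into_space by (auto simp: countable_partitions_def)
        then show ?thesis using Q(3) by (simp add: choice_function_def)
      qed
      then show "countable Q \<and> key_family (Suc (Suc j)) Q \<delta> \<and> \<Union>Q = A"
        using Q(1) P(2)[OF Q(2)] unfolding countable_partitions_def key_family_def by blast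
    qed
  qed
  show ?thesis
    unfolding has_sstar_integral_def
  proof (intro conjI allI impI)
    show "\<exists>Ps\<in>countable_partitions H A. \<forall>P\<in>countable_partitions H A. partition_le Ps P \<longrightarrow>
        (\<forall>\<delta>. choice_function \<Omega> \<delta> \<longrightarrow> (\<lambda>\<alpha>. p (f (\<delta> \<alpha>)) (\<mu> \<alpha>)) summable_on P)"
      using ex[of 0] Riemann_series_summable by meson
    fix U :: "'z set" assume "0 \<in> interior U"
    then obtain j where j: "W j \<subseteq> U" using W.base_W by blast
    obtain P\<^sub>0 where P\<^sub>0: "P\<^sub>0 \<in> countable_partitions H A"
      "\<forall>P\<in>countable_partitions H A. partition_le P\<^sub>0 P \<longrightarrow> (\<forall>\<delta>. choice_function \<Omega> \<delta> \<longrightarrow>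
        countable P \<and> key_family (Suc (Suc j)) P \<delta> \<and> \<Union>P = A)"
      using ex[of j] by blast
    show "\<exists>P\<^sub>0\<in>countable_partitions H A. \<forall>P\<in>countable_partitions H A. partition_le P\<^sub>0 P \<longrightarrow>
        (\<forall>\<delta>. choice_function \<Omega> \<delta> \<longrightarrow> (\<Sum>\<^sub>\<infinity>\<alpha>\<in>P. p (f (\<delta> \<alpha>)) (\<mu> \<alpha>)) - \<nu> A \<in> U)"
    proof (intro bexI[OF _ P\<^sub>0(1)] ballI impI allI)
      fix P \<delta>
      assume "P \<in> countable_partitions H A" "partition_le P\<^sub>0 P" "choice_function \<Omega> \<delta>"
      then have "countable P" "key_family (Suc (Suc j)) P \<delta>" "\<Union>P = A"
        using P\<^sub>0(2) by blast+
      then show "(\<Sum>\<^sub>\<infinity>\<alpha>\<in>P. p (f (\<delta> \<alpha>)) (\<mu> \<alpha>)) - \<nu> A \<in> U"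
        using Riemann_series_close[of P j \<delta>] j by auto
    qed
  qed
qed

end

context masse_integrand
begin

lemma has_sstar_integral:
  assumes "A \<in> H"
  shows "has_sstar_integral p \<Omega> H \<mu> A f (\<nu> A)"
proof -
  obtain W :: "nat \<Rightarrow> 'z set" where W: "zero_chain W"
    using zero_chain_exists[OF metrizable_Z] by blast
  interpret W: zero_chain W by (rule W)
  have "\<forall>k. \<exists>g E. simple_fun \<Omega> R g \<and> E \<in> H \<and> \<eta> E \<le> ennreal (1 / 2 ^ k) \<and>
    (\<forall>A\<in>H. level_integral g A - \<nu> A \<in> W k) \<and>
    (\<forall>C \<delta>. finite C \<longrightarrow> C \<subseteq> H \<longrightarrow> disjoint C \<longrightarrow> (\<forall>\<alpha>\<in>C. \<delta> \<alpha> \<in> \<Omega> - E) \<longrightarrow>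
      (\<Sum>\<alpha>\<in>C. p (g (\<delta> \<alpha>) - f (\<delta> \<alpha>)) (\<mu> \<alpha>)) \<in> W k)"
    using approximating_simple_function[OF W.closed_W W.zero_W] by simp
  then obtain g E where gE: "\<forall>k. simple_fun \<Omega> R (g k) \<and> E k \<in> H \<and> \<eta> (E k) \<le> ennreal (1 / 2 ^ k) \<and>
    (\<forall>A\<in>H. level_integral (g k) A - \<nu> A \<in> W k) \<and>
    (\<forall>C \<delta>. finite C \<longrightarrow> C \<subseteq> H \<longrightarrow> disjoint C \<longrightarrow> (\<forall>\<alpha>\<in>C. \<delta> \<alpha> \<in> \<Omega> - E k) \<longrightarrow>
      (\<Sum>\<alpha>\<in>C. p (g k (\<delta> \<alpha>) - f (\<delta> \<alpha>)) (\<mu> \<alpha>)) \<in> W k)"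
    unfolding choice_iff by (elim exE) (rule that)
  interpret egoroff_sequence \<Omega> H \<mu> p R S \<eta> D F f W g E
    by unfold_locales (use gE in blast)+
  show ?thesis using assms by (rule has_sstar_integral_indefinite)
qed

lemma simple_integral_limit:
  assumes "A \<in> H"
  shows "(simple_fun_integral p \<Omega> R \<mu> A \<longlongrightarrow> \<nu> A) F"
proof (rule Lim_transform_eventually[OF indefinite_integral_limit[OF assms]])
  show "\<forall>\<^sub>F s in F. level_integral s A = simple_fun_integral p \<Omega> R \<mu> A s"
    using eventually_simple by (rule eventually_mono) (simp add: simple_fun_integral_eq assms)
qed

end

section \<open>Agreement of the two integrals\<close>

theorem theorem5p7:
  fixes p :: "'x::{real_tvs,t2_space} \<Rightarrow> 'y::{real_tvs,t2_space} \<Rightarrow> 'z::{real_tvs,t2_space}"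
    and D :: "('x \<Rightarrow> real) set"
    and \<Omega> :: "'w set" and H R :: "'w set set"
    and S :: "('w set \<Rightarrow> ennreal) set"
    and \<mu> :: "'w set \<Rightarrow> 'y" and f :: "'w \<Rightarrow> 'x"
  assumes complete: "tvs_complete TYPE('x)" "tvs_complete TYPE('y)" "tvs_complete TYPE('z)"
    and metrizable: "metrizable_space (euclidean :: 'x topology)"
      "metrizable_space (euclidean :: 'y topology)" "metrizable_space (euclidean :: 'z topology)"
    and bilinear: "separately_continuous_bilinear p"
    and D: "defining_F_seminorms D"
    and H: "sigma_algebra \<Omega> H"
    and S: "S \<noteq> {}" "\<forall>\<xi>\<in>S. submeasure H \<xi>" "\<exists>\<eta>. control_submeasure H S \<eta>"
    and \<mu>: "sigma_additive H \<mu>" "finite_semivariation p H \<mu>"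
    and R: "ring_of_sets \<Omega> R" "R \<subseteq> H"
    and null_integrable: "\<forall>E\<in>H. (\<forall>\<xi>\<in>S. \<xi> E = 0) \<longrightarrow> E \<in> R"
    and M1: "masse_M1 p \<Omega> R \<mu>"
    and M2: "masse_M2 p R S \<mu>"
    and f: "masse_integrable p \<Omega> H S D R \<mu> f"
  shows "\<forall>A\<in>H. has_sstar_integral p \<Omega> H \<mu> A f (masse_integral p \<Omega> H S D R \<mu> A f)"
proof
  fix A assume A: "A \<in> H"
  obtain \<eta> where \<eta>: "control_submeasure H S \<eta>" using S(3) by blast
  have setting: "masse_integrand \<Omega> H \<mu> p R S \<eta> D F f" if "masse_approx p \<Omega> H S D R \<mu> F f" for F
    by (intro masse_integrand.intro masse_setting.intro bilinear_vector_measure.intro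
        vector_measure.intro vector_measure_axioms.intro bilinear_vector_measure_axioms.intro
        masse_setting_axioms.intro masse_integrand_axioms.intro) (fact assms \<eta> that)+
  have sstar: "has_sstar_integral p \<Omega> H \<mu> A f z"
    if "masse_approx p \<Omega> H S D R \<mu> F f" "(simple_fun_integral p \<Omega> R \<mu> A \<longlongrightarrow> z) F" for F z
  proof -
    interpret masse_integrand \<Omega> H \<mu> p R S \<eta> D F f by (rule setting[OF that(1)])
    have "z = indefinite_integral A"
      using tendsto_unique[OF F_nonbot that(2) simple_integral_limit[OF A]] .
    then show ?thesis using has_sstar_integral[OF A] by simp
  qed
  obtain F where F: "masse_approx p \<Omega> H S D R \<mu> F f"
    using f by (auto simp: masse_integrable_def)
  interpret masse_integrand \<Omega> H \<mu> p R S \<eta> D F f by (rule setting[OF F])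
  have "masse_integral p \<Omega> H S D R \<mu> A f = indefinite_integral A"
    unfolding masse_integral_def
  proof (rule the_equality)
    show "\<exists>F. masse_approx p \<Omega> H S D R \<mu> F f \<and>
        (simple_fun_integral p \<Omega> R \<mu> A \<longlongrightarrow> indefinite_integral A) F"
      using F simple_integral_limit[OF A] by blast
  next
    fix z assume "\<exists>F. masse_approx p \<Omega> H S D R \<mu> F f \<and> (simple_fun_integral p \<Omega> R \<mu> A \<longlongrightarrow> z) F"
    then have "has_sstar_integral p \<Omega> H \<mu> A f z" using sstar by blast
    then show "z = indefinite_integral A"
      using sstar_integral_unique[OF H] has_sstar_integral[OF A] by blast
  qed
  then show "has_sstar_integral p \<Omega> H \<mu> A f (masse_integral p \<Omega> H S D R \<mu> A f)"
    using has_sstar_integral[OF A] by simp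
qed

end
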